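(* Let $\Lambda$ be a space with measure $\mu$. Suppose that the kernel $K$ of a $\Lambda$-valued Pfaffian point field has finite rank, and let $f:\Lambda\to\mathbb{C}$ be a complex-valued function. Then $$\mathbb{E}\prod_{k}\left(1+f(x_k)\right)=\mathrm{Det}_M\left(I+\sqrt{f(x)}\,K\,\sqrt{f(y)}\right),$$ where the product is extended over all points $x_k$ of the field, whenever the terms on both sides of this equality are well-defined.
   Context: Quaternions. "Quaternions" are complexified quaternions $q=s+x\mathbf{i}+y\mathbf{j}+z\mathbf{k}\in\mathbb{Q}_{\mathbb{C}}$ with $s,x,y,z\in\mathbb{C}$ (usual quaternion multiplication rules, complex scalars central). The conjugate is $q^{*}=s-x\mathbf{i}-y\mathbf{j}-z\mathbf{k}$ (the coefficients are not complex-conjugated). The dual $X^*$ of a quaternion matrix is given by $(X^* )_{lk}=(X_{kl})^*$; $X$ is self-dual if $X^*=X$. A quaternion kernel $K:\Lambda\times\Lambda\to\mathbb{Q}_{\mathbb{C}}$ is self-dual if $K(y,x)=K(x,y)^*$. Moore-Dyson determinant. For an $n\times n$ quaternion matrix $X$, write each permutation $\sigma\in S_n$ as a product of cycles $\sigma=(n_1i_2\ldots i_s)(n_2j_2\ldots j_t)\ldots(n_rk_2\ldots k_l)$ where $n_i$ is the largest element of its cycle and $n_1>n_2>\ldots>n_r$. Then $\mathrm{Det}_M(X)=\sum_{\sigma}(-1)^{n-r}\left(X_{n_1i_2}X_{i_2i_3}\ldots X_{i_sn_1}\right)\ldots\left(X_{n_rk_2}X_{k_2k_3}\ldots X_{k_ln_r}\right)$.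 It is scalar for self-dual $X$. Fredholm version. For a self-dual kernel $L(x,y)$, $\mathrm{Det}_M(I+L):=1+\sum_{n=1}^\infty\frac1{n!}\int_{\Lambda^n}\mathrm{Det}_M(L(x_i,x_j))_{1\le i,j\le n}\,d\mu(x_1)\cdots d\mu(x_n)$. Here it is applied to the kernel $L(x,y)=\sqrt{f(x)}\,K(x,y)\,\sqrt{f(y)}$, where $\sqrt{f}$ is a fixed choice of complex square root of $f$. Random point fields. A random point field on $\Lambda$ is a probability measure on the space of countable configurations of points of $\Lambda$ (with finitely many points in every compact subset). $\#(A)$ is the number of points in $A$. A locally integrable $R_k:\Lambda^k\to\mathbb{R}_+$ is the $k$-point correlation function with respect to $\mu$ if for all disjoint measurable $A_1,\ldots,A_m\subset\Lambda$ and non-negative integers $k_i$ with $\sum k_i=k$: $\mathbb{E}\prod_{i=1}^m[\#(A_i)\cdots(\#(A_i)-k_i+1)]=\int_{A_1^{k_1}\times\cdots\times A_m^{k_m}}R_k\,d\mu(x_1)\cdots d\mu(x_k)$. The field is Pfaffian with kernel $K$ if $K$ is a self-dual quaternion kernel and $R_m(x_1,\ldots,x_m)=\mathrm{Det}_M(K(x_i,x_j))_{1\le i,j\le m}$ for all $m\ge1$. Finite rank. $K$ has finite rank if the integral operator it defines (on $L^2(\Lambda,\mu;\mathbb{C}^2)$ after replacing $\mathbb{Q}_{\mathbb{C}}$ by $M_2(\mathbb{C})$ through the standard isomorphism) has finite rank. *)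

theory Defs
  imports "HOL-Probability.Probability" "HOL-Combinatorics.Cycles"
begin

text \<open>\<^term>\<open>CQuat s x y z\<close> stands for $s + x\mathbf{i} + y\mathbf{j} + z\mathbf{k}$.\<close>

datatype cquat = CQuat (cq_scalar: complex) (cq_i: complex) (cq_j: complex) (cq_k: complex)

instantiation cquat :: ring_1
begin

definition zero_cquat :: cquat where "0 = CQuat 0 0 0 0"

definition one_cquat :: cquat where "1 = CQuat 1 0 0 0"

definition plus_cquat :: "cquat \<Rightarrow> cquat \<Rightarrow> cquat" where
  "p + q = CQuat (cq_scalar p + cq_scalar q) (cq_i p + cq_i q) (cq_j p + cq_j q) (cq_k p + cq_k q)"

definition minus_cquat :: "cquat \<Rightarrow> cquat \<Rightarrow> cquat" where
  "p - q = CQuat (cq_scalar p - cq_scalar q) (cq_i p - cq_i q) (cq_j p - cq_j q) (cq_k p - cq_k q)"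

definition uminus_cquat :: "cquat \<Rightarrow> cquat" where
  "- q = CQuat (- cq_scalar q) (- cq_i q) (- cq_j q) (- cq_k q)"

definition times_cquat :: "cquat \<Rightarrow> cquat \<Rightarrow> cquat" where
  "p * q = CQuat
     (cq_scalar p * cq_scalar q - cq_i p * cq_i q - cq_j p * cq_j q - cq_k p * cq_k q)
     (cq_scalar p * cq_i q + cq_i p * cq_scalar q + cq_j p * cq_k q - cq_k p * cq_j q)
     (cq_scalar p * cq_j q - cq_i p * cq_k q + cq_j p * cq_scalar q + cq_k p * cq_i q)
     (cq_scalar p * cq_k q + cq_i p * cq_j q - cq_j p * cq_i q + cq_k p * cq_scalar q)"

instance
  by standard
    (simp_all add: zero_cquat_def one_cquat_def plus_cquat_def minus_cquat_def uminus_cquat_def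
      times_cquat_def cquat.expand algebra_simps)

end

definition cq_of_complex :: "complex \<Rightarrow> cquat" where
  "cq_of_complex c = CQuat c 0 0 0"

text \<open>The coefficients are not complex-conjugated.\<close>

definition cq_conj :: "cquat \<Rightarrow> cquat" where
  "cq_conj q = CQuat (cq_scalar q) (- cq_i q) (- cq_j q) (- cq_k q)"

text \<open>The standard isomorphism with $M_2(\mathbb{C})$:
  $\mathbf{i} \mapsto \mathrm{diag}(\mathrm{i},-\mathrm{i})$, and $\mathbf{j}$ is sent to the matrix
  with rows $(0,1)$, $(-1,0)$.\<close>

definition cq_matrix :: "cquat \<Rightarrow> complex ^ 2 ^ 2" where
  "cq_matrix q = vector
     [vector [cq_scalar q + \<i> * cq_i q, cq_j q + \<i> * cq_k q],
      vector [- cq_j q + \<i> * cq_k q, cq_scalar q - \<i> * cq_i q]]"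

text \<open>Matrices are indexed by \<open>{..<n}\<close>. A cycle is represented by its largest element, and
  \<^term>\<open>support \<sigma> m\<close> is the list of \<open>m, \<sigma> m, \<sigma> (\<sigma> m), \<dots>\<close> up to the end of the cycle.
  The products are ordered because quaternions do not commute.\<close>

definition cycle_maxima :: "nat \<Rightarrow> (nat \<Rightarrow> nat) \<Rightarrow> nat list" where
  "cycle_maxima n \<sigma> = filter (\<lambda>m. \<forall>k. (\<sigma> ^^ k) m \<le> m) (rev [0..<n])"

definition cycle_product :: "(nat \<Rightarrow> nat \<Rightarrow> cquat) \<Rightarrow> (nat \<Rightarrow> nat) \<Rightarrow> nat \<Rightarrow> cquat" where
  "cycle_product X \<sigma> m = prod_list (map (\<lambda>i. X i (\<sigma> i)) (support \<sigma> m))"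

definition Det_M :: "nat \<Rightarrow> (nat \<Rightarrow> nat \<Rightarrow> cquat) \<Rightarrow> cquat" where
  "Det_M n X = (\<Sum>\<sigma> | \<sigma> permutes {..<n}.
     (- 1) ^ (n - length (cycle_maxima n \<sigma>)) *
     prod_list (map (cycle_product X \<sigma>) (cycle_maxima n \<sigma>)))"

definition self_dual_kernel :: "('a \<Rightarrow> 'a \<Rightarrow> cquat) \<Rightarrow> bool" where
  "self_dual_kernel K \<longleftrightarrow> (\<forall>x y. K y x = cq_conj (K x y))"

definition L2_C2 :: "'a measure \<Rightarrow> ('a \<Rightarrow> complex ^ 2) set" where
  "L2_C2 M = {g \<in> borel_measurable M. integrable M (\<lambda>x. (norm (g x))\<^sup>2)}"

definition kernel_operator ::
  "'a measure \<Rightarrow> ('a \<Rightarrow> 'a \<Rightarrow> cquat) \<Rightarrow> ('a \<Rightarrow> complex ^ 2) \<Rightarrow> 'a \<Rightarrow> complex ^ 2" where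
  "kernel_operator M K g x = (LINT y|M. cq_matrix (K x y) *v g y)"

definition defines_operator :: "'a measure \<Rightarrow> ('a \<Rightarrow> 'a \<Rightarrow> cquat) \<Rightarrow> bool" where
  "defines_operator M K \<longleftrightarrow>
     (\<lambda>(x, y). cq_matrix (K x y)) \<in> borel_measurable (M \<Otimes>\<^sub>M M) \<and>
     (\<forall>g \<in> L2_C2 M. (AE x in M. integrable M (\<lambda>y. cq_matrix (K x y) *v g y)) \<and>
        kernel_operator M K g \<in> L2_C2 M)"

text \<open>Elements of $L^2$ are represented by functions, so that the range of the operator is
  contained in a finite-dimensional subspace up to null sets.\<close>

definition finite_rank_kernel :: "'a measure \<Rightarrow> ('a \<Rightarrow> 'a \<Rightarrow> cquat) \<Rightarrow> bool" where
  "finite_rank_kernel M K \<longleftrightarrow> defines_operator M K \<and>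
     (\<exists>B. finite B \<and> B \<subseteq> L2_C2 M \<and>
        (\<forall>g \<in> L2_C2 M. \<exists>c. AE x in M. kernel_operator M K g x = (\<Sum>b\<in>B. c b *s b x)))"

text \<open>For a self-dual kernel the Moore-Dyson determinants are scalar, and their scalar part is
  what gets integrated.\<close>

definition fredholm_integrand :: "('a \<Rightarrow> 'a \<Rightarrow> cquat) \<Rightarrow> nat \<Rightarrow> (nat \<Rightarrow> 'a) \<Rightarrow> complex" where
  "fredholm_integrand L n x = cq_scalar (Det_M n (\<lambda>i j. L (x i) (x j)))"

text \<open>The expansion is well-defined if the integrals and their series converge absolutely.\<close>

definition fredholm_Det_M_defined :: "'a measure \<Rightarrow> ('a \<Rightarrow> 'a \<Rightarrow> cquat) \<Rightarrow> bool" where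
  "fredholm_Det_M_defined M L \<longleftrightarrow>
     (\<forall>n\<ge>1. integrable (Pi\<^sub>M {..<n} (\<lambda>_. M)) (fredholm_integrand L n)) \<and>
     summable (\<lambda>n. (LINT x|Pi\<^sub>M {..<Suc n} (\<lambda>_. M). norm (fredholm_integrand L (Suc n) x))
                     / fact (Suc n))"

definition fredholm_Det_M :: "'a measure \<Rightarrow> ('a \<Rightarrow> 'a \<Rightarrow> cquat) \<Rightarrow> complex" where
  "fredholm_Det_M M L =
     1 + (\<Sum>n. (LINT x|Pi\<^sub>M {..<Suc n} (\<lambda>_. M). fredholm_integrand L (Suc n) x) / fact (Suc n))"

text \<open>A configuration is represented by its multiplicity function: \<open>\<xi> x\<close> is the number of points
  located at \<open>x\<close>. Configurations without multiple points are those with values in \<open>{0, 1}\<close>.\<close>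

type_synonym 'a config = "'a \<Rightarrow> nat"

definition configs :: "('a::topological_space) config set" where
  "configs = {\<xi>. countable {x. \<xi> x > 0} \<and> (\<forall>C. compact C \<longrightarrow> finite {x \<in> C. \<xi> x > 0})}"

definition num_points :: "'a config \<Rightarrow> 'a set \<Rightarrow> ennreal" where
  "num_points \<xi> A = (\<integral>\<^sup>+x\<in>A. of_nat (\<xi> x) \<partial>count_space UNIV)"

text \<open>Any \<open>\<sigma>\<close>-algebra for which all the counts are measurable is admitted.\<close>

definition random_point_field :: "('a::topological_space) config measure \<Rightarrow> bool" where
  "random_point_field P \<longleftrightarrow> prob_space P \<and> space P = configs \<and>
     (\<forall>A \<in> sets borel. (\<lambda>\<xi>. num_points \<xi> A) \<in> borel_measurable P)"

text \<open>The list in which \<open>A 0\<close> is repeated \<open>k 0\<close> times, then \<open>A 1\<close> is repeated \<open>k 1\<close> times, etc.;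
  its product is $A_1^{k_1} \times \dots \times A_m^{k_m}$.\<close>

definition block_list :: "nat \<Rightarrow> (nat \<Rightarrow> 'a set) \<Rightarrow> (nat \<Rightarrow> nat) \<Rightarrow> 'a set list" where
  "block_list m A k = concat (map (\<lambda>i. replicate (k i) (A i)) [0..<m])"

text \<open>Local integrability only needs to be tested on the compact sets $C^n$. Subtraction on
  \<^typ>\<open>ennreal\<close> is truncated at \<open>0\<close>, which does not affect falling factorials, and
  \<open>\<infinity> - j = \<infinity>\<close>, \<open>0 * \<infinity> = 0\<close>.\<close>

definition correlation_function ::
  "('a::topological_space) measure \<Rightarrow> 'a config measure \<Rightarrow> nat \<Rightarrow> ((nat \<Rightarrow> 'a) \<Rightarrow> real) \<Rightarrow> bool" where
  "correlation_function M P n R \<longleftrightarrow>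
     R \<in> borel_measurable (Pi\<^sub>M {..<n} (\<lambda>_. M)) \<and>
     (\<forall>x. R x \<ge> 0) \<and>
     (\<forall>C. compact C \<longrightarrow> set_integrable (Pi\<^sub>M {..<n} (\<lambda>_. M)) (PiE {..<n} (\<lambda>_. C)) R) \<and>
     (\<forall>m A k. (\<forall>i<m. A i \<in> sets M) \<and> disjoint_family_on A {..<m} \<and> (\<Sum>i<m. k i) = n \<longrightarrow>
        (\<integral>\<^sup>+\<xi>. (\<Prod>i<m. \<Prod>j<k i. num_points \<xi> (A i) - of_nat j) \<partial>P) =
        (\<integral>\<^sup>+x\<in>PiE {..<n} (\<lambda>i. block_list m A k ! i). ennreal (R x) \<partial>Pi\<^sub>M {..<n} (\<lambda>_. M)))"

text \<open>Correlation functions are only determined up to null sets.\<close>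

definition pfaffian_field ::
  "('a::topological_space) measure \<Rightarrow> 'a config measure \<Rightarrow> ('a \<Rightarrow> 'a \<Rightarrow> cquat) \<Rightarrow> bool" where
  "pfaffian_field M P K \<longleftrightarrow> random_point_field P \<and> self_dual_kernel K \<and>
     (\<forall>n\<ge>1. \<exists>R. correlation_function M P n R \<and>
        (AE x in Pi\<^sub>M {..<n} (\<lambda>_. M).
           cq_of_complex (of_real (R x)) = Det_M n (\<lambda>i j. K (x i) (x j))))"

text \<open>The product of \<open>g\<close> over all points of a configuration (with multiplicities). The points come
  without an order, so the product is the limit along the finite sets of points.\<close>

definition has_config_prod :: "('a \<Rightarrow> complex) \<Rightarrow> 'a config \<Rightarrow> complex \<Rightarrow> bool" where
  "has_config_prod g \<xi> p \<longleftrightarrow>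
     ((\<lambda>F. \<Prod>x\<in>F. g x ^ \<xi> x) \<longlongrightarrow> p) (finite_subsets_at_top {x. \<xi> x > 0})"

definition config_prod :: "('a \<Rightarrow> complex) \<Rightarrow> 'a config \<Rightarrow> complex" where
  "config_prod g \<xi> = (THE p. has_config_prod g \<xi> p)"

definition expected_config_prod_defined :: "'a config measure \<Rightarrow> ('a \<Rightarrow> complex) \<Rightarrow> bool" where
  "expected_config_prod_defined P g \<longleftrightarrow>
     (AE \<xi> in P. \<exists>p. has_config_prod g \<xi> p) \<and> integrable P (config_prod g)"

end

theory Submission
  imports Defs "HOL-Combinatorics.Orbits"
begin

text \<open>Formally $\prod_k (1 + f(x_k)) = \sum_n \frac{1}{n!} \sum f(x_{k_1}) \cdots f(x_{k_n})$ over
  tuples of distinct points, the expectation of the inner sum is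
  $\int f(x_1) \cdots f(x_n) R_n\,d\mu^n$, and conjugating the kernel by $\sqrt f$ multiplies the
  $n$-th Moore-Dyson determinant by $f(x_1) \cdots f(x_n)$.

  For a step function \<open>f\<close> the expansion is the binomial theorem in the counts $\#(A_i)$, and the
  correlation functions give the factorial moments of the counts. This needs the integrals of
  $R_n$ over products of the \<open>A i\<close> in every order, hence the symmetry of $R_n$, which is the invariance of
  the determinant of a self-dual matrix under simultaneous permutations of rows and columns:
  reversing a cycle conjugates its factor, so only scalar parts of cycle products survive, and
  these do not depend on the starting points of the cycles. Simple approximations
  dominated by $|f|$ and the absolute convergence of the Fredholm expansion then give the general
  case. Measurability of \<open>f\<close> is not assumed; it holds up to a set which a.s. contains no points.\<close>

subsection \<open>Quaternions\<close>

text \<open>Both sides are controlled by one number, \<open>abs_expansion\<close>: the sum over n of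
  1/n! times the integral of |f(x_1)|...|f(x_n)| R_n. Since R_n is nonnegative, absolute convergence
  of the Fredholm expansion says exactly that this number is finite, and for step functions it is
  the expectation of the product of 1 + |f(x_k)|. The hypothesis on the left side only gives
  convergence of the random product and integrability of its value, hence no bound common to all
  approximations; such a bound has to come from the right side. The moduli of the approximations
  need not be monotone, so it is obtained from Fatou's lemma instead of monotone convergence. As for
  measurability, the Fredholm integrands are measurable even though f need not be. For n = 1 the
  integrand is f R_1, so f can be recovered by division where R_1 is nonzero. On the zero set of R_1
  the expected number of points is 0, and every R_n vanishes almost everywhere on tuples meeting it,
  so changing f there affects neither side.\<close>

lemma cq_scalar_simps [simp]:
  "cq_scalar 0 = 0" "cq_scalar 1 = 1" "cq_scalar (p + q) = cq_scalar p + cq_scalar q"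
  "cq_scalar (p - q) = cq_scalar p - cq_scalar q" "cq_scalar (- p) = - cq_scalar p"
  "cq_scalar (cq_of_complex c) = c" "cq_scalar (cq_conj p) = cq_scalar p"
  by (simp_all add: zero_cquat_def one_cquat_def plus_cquat_def minus_cquat_def uminus_cquat_def
      cq_of_complex_def cq_conj_def)

lemma cq_scalar_sum: "cq_scalar (\<Sum>i\<in>A. g i) = (\<Sum>i\<in>A. cq_scalar (g i))"
  by (induction A rule: infinite_finite_induct) simp_all

text \<open>The scalar part is half the trace of \<open>cq_matrix\<close>, hence invariant under
  cyclic shifts. This is why scalar parts of cycle products do not depend on the starting
  point.\<close>

lemma cq_scalar_mult_commute: "cq_scalar (p * q) = cq_scalar (q * p)"
  by (simp add: times_cquat_def algebra_simps)

lemma cq_scalar_of_complex_mult [simp]: "cq_scalar (cq_of_complex c * q) = c * cq_scalar q"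
  by (simp add: times_cquat_def cq_of_complex_def)

lemma cq_of_complex_mult: "cq_of_complex (a * b) = cq_of_complex a * cq_of_complex b"
  and cq_of_complex_one [simp]: "cq_of_complex 1 = 1"
  and cq_of_complex_minus: "cq_of_complex (- a) = - cq_of_complex a"
  by (simp_all add: times_cquat_def cq_of_complex_def one_cquat_def uminus_cquat_def)

lemma cq_of_complex_power: "cq_of_complex (a ^ k) = cq_of_complex a ^ k"
  by (induction k) (simp_all add: cq_of_complex_mult)

lemma cq_of_complex_prod_list:
  "prod_list (map (\<lambda>x. cq_of_complex (h x)) xs) = cq_of_complex (prod_list (map h xs))"
  by (induction xs) (simp_all add: cq_of_complex_mult)

lemma cq_of_complex_central: "cq_of_complex a * q = q * cq_of_complex a"
  by (simp add: times_cquat_def cq_of_complex_def algebra_simps)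

lemma cq_mult_of_complex_left: "p * (cq_of_complex b * q) = cq_of_complex b * (p * q)"
  by (simp add: mult.assoc[symmetric] cq_of_complex_central[of b p])

lemma cq_mult_of_complex:
  "cq_of_complex a * p * (cq_of_complex b * q) = cq_of_complex (a * b) * (p * q)"
  by (simp add: cq_of_complex_mult mult.assoc cq_mult_of_complex_left[of p])

lemma cq_conj_mult: "cq_conj (p * q) = cq_conj q * cq_conj p"
  by (simp add: times_cquat_def cq_conj_def algebra_simps)

lemma cq_conj_prod_list: "cq_conj (prod_list xs) = prod_list (rev (map cq_conj xs))"
  by (induction xs) (simp_all add: cq_conj_mult, simp add: cq_conj_def one_cquat_def)

lemma cq_add_conj: "q + cq_conj q = cq_of_complex (cq_scalar q) + cq_of_complex (cq_scalar q)"
  by (simp add: plus_cquat_def cq_conj_def cq_of_complex_def)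

lemma cq_double_cancel: "p + p = q + q \<Longrightarrow> (p::cquat) = q"
  by (cases p; cases q) (simp add: plus_cquat_def)

lemma cq_scalar_prod_list_rotate1: "cq_scalar (prod_list (rotate1 xs)) = cq_scalar (prod_list xs)"
  by (cases xs) (simp_all add: cq_scalar_mult_commute)

subsection \<open>Cycles of permutations\<close>

lemma orbit_eq:
  assumes "permutation \<sigma>" "b \<in> orbit \<sigma> a"
  shows "orbit \<sigma> b = orbit \<sigma> a"
  using orbit_cyclic_eq3[OF cyclic_on_orbit'[OF assms(1)] assms(2)] .

lemma set_support:
  assumes "permutation \<sigma>"
  shows "set (support \<sigma> a) = orbit \<sigma> a"
  using support_set[OF assms, of a] orbit_altdef_permutation[OF assms, of a] by auto

lemma least_power_eq_card_orbit:
  assumes "permutation \<sigma>"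
  shows "least_power \<sigma> a = card (orbit \<sigma> a)"
proof -
  have "card (set (support \<sigma> a)) = length (support \<sigma> a)"
    using cycle_of_permutation[OF assms] distinct_card by blast
  then show ?thesis using set_support[OF assms] by simp
qed

text \<open>Both starting points lie on the same cycle, so the two lists have the same length L, and
  the new list ends with \<open>(\<sigma> ^^ L) a\<close>, which is a again.\<close>

lemma support_step:
  assumes "permutation \<sigma>"
  shows "support \<sigma> (\<sigma> a) = rotate1 (support \<sigma> a)"
proof -
  define L where "L = least_power \<sigma> a"
  have L: "least_power \<sigma> (\<sigma> a) = L" "(\<sigma> ^^ L) a = a" "L > 0"
    using least_power_eq_card_orbit[OF assms] permutation_orbit_step[OF assms]
      least_power_of_permutation[OF assms] by (simp_all add: L_def)
  have "support \<sigma> (\<sigma> a) = map (\<lambda>i. (\<sigma> ^^ i) a) (map Suc [0..<L])"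
    by (simp add: L funpow_swap1 del: map_Suc_upt)
  also have "map Suc [0..<L] = [1..<L] @ [L]"
    using L(3) by (simp add: map_Suc_upt)
  also have "map (\<lambda>i. (\<sigma> ^^ i) a) \<dots> = rotate1 (map (\<lambda>i. (\<sigma> ^^ i) a) [0..<L])"
    using L by (simp add: upt_conv_Cons)
  finally show ?thesis by (simp add: L_def)
qed

lemma cq_scalar_cycle_product_step:
  assumes "permutation \<sigma>"
  shows "cq_scalar (cycle_product X \<sigma> (\<sigma> a)) = cq_scalar (cycle_product X \<sigma> a)"
  unfolding cycle_product_def support_step[OF assms] rotate1_map[symmetric]
  by (rule cq_scalar_prod_list_rotate1)

lemma cq_scalar_cycle_product_orbit:
  assumes "permutation \<sigma>" "b \<in> orbit \<sigma> a"
  shows "cq_scalar (cycle_product X \<sigma> b) = cq_scalar (cycle_product X \<sigma> a)"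
  using assms(2) by induction (simp_all add: cq_scalar_cycle_product_step[OF assms(1)])

lemma cycle_product_altdef:
  "cycle_product X \<sigma> m =
     prod_list (map (\<lambda>i. X ((\<sigma> ^^ i) m) ((\<sigma> ^^ Suc i) m)) [0..<least_power \<sigma> m])"
  by (simp add: cycle_product_def comp_def)

text \<open>Everything attached to one cycle is computed from the iterates of m, so a permutation
  may be altered on the other cycles at will. This isolates the effect of reversing a single
  cycle.\<close>

lemma cycle_product_cong:
  assumes "permutation \<sigma>" and eq: "\<And>x. x \<in> orbit \<sigma> m \<Longrightarrow> \<sigma>' x = \<sigma> x"
  shows "cycle_product X \<sigma>' m = cycle_product X \<sigma> m" "orbit \<sigma>' m = orbit \<sigma> m"
proof -
  have pow: "(\<sigma>' ^^ i) m = (\<sigma> ^^ i) m" for i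
  proof (induction i)
    case (Suc i)
    have "(\<sigma> ^^ i) m \<in> orbit \<sigma> m"
      using orbit_altdef_permutation[OF assms(1)] by blast
    then show ?case using Suc eq by simp
  qed simp
  then show "cycle_product X \<sigma>' m = cycle_product X \<sigma> m"
    by (simp only: cycle_product_altdef least_power_def)
  show "orbit \<sigma>' m = orbit \<sigma> m"
    using pow by (simp add: orbit_altdef)
qed

text \<open>Conjugation carries cycles to cycles, but not largest elements to largest elements. The
  symmetry of the determinant therefore calls for arbitrary systems of cycle representatives in
  place of \<open>cycle_maxima\<close>.\<close>

definition transversal :: "nat \<Rightarrow> (nat \<Rightarrow> nat) \<Rightarrow> nat set \<Rightarrow> bool" where
  "transversal n \<sigma> T \<longleftrightarrow> T \<subseteq> {..<n} \<and> (\<forall>x<n. \<exists>!t. t \<in> T \<and> t \<in> orbit \<sigma> x)"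

lemma transversal_unique:
  assumes "transversal n \<sigma> T" "x < n" "s \<in> T" "t \<in> T" "s \<in> orbit \<sigma> x" "t \<in> orbit \<sigma> x"
  shows "s = t"
  using assms ex1_implies_ex unfolding transversal_def by (metis (no_types, lifting))

text \<open>Sending each element of T to the element of T' on the same cycle is a bijection, and a
  function constant on cycles does not notice the change. Equal cardinalities serve to compare the
  signs.\<close>

lemma transversal_prod:
  fixes h :: "nat \<Rightarrow> 'b::comm_monoid_mult"
  assumes "permutation \<sigma>" "transversal n \<sigma> T" "transversal n \<sigma> T'"
    and h: "\<And>a b. b \<in> orbit \<sigma> a \<Longrightarrow> h b = h a"
  shows "prod h T = prod h T'" "card T = card T'"
proof -
  define r where "r U x = (THE t. t \<in> U \<and> t \<in> orbit \<sigma> x)" for U x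
  have r: "r U x \<in> U" "r U x \<in> orbit \<sigma> x" if "transversal n \<sigma> U" "x < n" for U x
    using theI'[of "\<lambda>t. t \<in> U \<and> t \<in> orbit \<sigma> x"] that by (auto simp: transversal_def r_def)
  have lt: "x < n" if "transversal n \<sigma> U" "x \<in> U" for U x
    using that by (auto simp: transversal_def)
  have inv: "r U (r V x) = x" if U: "transversal n \<sigma> U" and V: "transversal n \<sigma> V" and x: "x \<in> U" for U V x
  proof -
    have xn: "x < n" "r V x < n" using lt[OF U x] lt[OF V] r[OF V] by auto
    have "orbit \<sigma> (r V x) = orbit \<sigma> x" using orbit_eq[OF assms(1) r(2)[OF V xn(1)]] .
    then have "r U (r V x) \<in> orbit \<sigma> x" using r(2)[OF U xn(2)] by simp
    moreover have "x \<in> orbit \<sigma> x" using permutation_self_in_orbit[OF assms(1)] .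
    moreover have "r U (r V x) \<in> U" using r(1)[OF U xn(2)] .
    ultimately show ?thesis using transversal_unique[OF U xn(1)] x by blast
  qed
  note T = assms(2,3)
  show "prod h T = prod h T'"
    by (rule prod.reindex_bij_witness[of T "r T" "r T'"])
      (auto simp: inv T r lt[OF T(1)] lt[OF T(2)] intro: h)
  have "bij_betw (r T') T T'"
    by (rule bij_betw_byWitness[of _ "r T"]) (auto simp: inv T r lt[OF T(1)] lt[OF T(2)])
  then show "card T = card T'" by (rule bij_betw_same_card)
qed

lemma cycle_maximum_iff:
  assumes "permutation \<sigma>"
  shows "(\<forall>k. (\<sigma> ^^ k) m \<le> m) \<longleftrightarrow> (\<forall>y\<in>orbit \<sigma> m. y \<le> m)"
  using orbit_altdef_permutation[OF assms, of m] by auto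

lemma permutes_lessThan_permutation:
  "\<sigma> permutes {..<n::nat} \<Longrightarrow> permutation \<sigma>"
  using permutation_permutes by blast

lemma transversal_cycle_maxima:
  assumes "\<sigma> permutes {..<n}"
  shows "transversal n \<sigma> (set (cycle_maxima n \<sigma>))"
  unfolding transversal_def
proof (intro conjI allI impI)
  note p = permutes_lessThan_permutation[OF assms]
  show "set (cycle_maxima n \<sigma>) \<subseteq> {..<n}" by (auto simp: cycle_maxima_def)
  fix x assume "x < n"
  then have sub: "orbit \<sigma> x \<subseteq> {..<n}" using permutes_orbit_subset[OF assms] by auto
  have fin: "finite (orbit \<sigma> x)" using sub finite_subset by blast
  have ne: "orbit \<sigma> x \<noteq> {}" by (rule orbit_nonempty)
  show "\<exists>!t. t \<in> set (cycle_maxima n \<sigma>) \<and> t \<in> orbit \<sigma> x"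
  proof (rule ex1I[of _ "Max (orbit \<sigma> x)"])
    have M: "Max (orbit \<sigma> x) \<in> orbit \<sigma> x" using Max_in[OF fin ne] .
    then show "Max (orbit \<sigma> x) \<in> set (cycle_maxima n \<sigma>) \<and> Max (orbit \<sigma> x) \<in> orbit \<sigma> x"
      using sub fin orbit_eq[OF p M] by (auto simp: cycle_maxima_def cycle_maximum_iff[OF p])
    fix t assume t: "t \<in> set (cycle_maxima n \<sigma>) \<and> t \<in> orbit \<sigma> x"
    then have "orbit \<sigma> t = orbit \<sigma> x" using orbit_eq[OF p] by blast
    then have "\<forall>y\<in>orbit \<sigma> x. y \<le> t"
      using t by (auto simp: cycle_maxima_def cycle_maximum_iff[OF p])
    then show "t = Max (orbit \<sigma> x)" using t fin by (intro Max_eqI[symmetric]) auto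
  qed
qed

lemma distinct_cycle_maxima: "distinct (cycle_maxima n \<sigma>)"
  by (simp add: cycle_maxima_def)

subsection \<open>Reversing a cycle\<close>

definition reverse_cycle :: "nat \<Rightarrow> (nat \<Rightarrow> nat) \<Rightarrow> nat \<Rightarrow> nat" where
  "reverse_cycle m \<sigma> x = (if x \<in> orbit \<sigma> m then inv \<sigma> x else \<sigma> x)"

lemma orbit_step_iff:
  assumes "permutation \<sigma>"
  shows "\<sigma> x \<in> orbit \<sigma> m \<longleftrightarrow> x \<in> orbit \<sigma> m" "inv \<sigma> x \<in> orbit \<sigma> m \<longleftrightarrow> x \<in> orbit \<sigma> m"
proof -
  have eq: "y \<in> orbit \<sigma> m \<longleftrightarrow> orbit \<sigma> y = orbit \<sigma> m" for y
    using orbit_eq[OF assms] permutation_self_in_orbit[OF assms] by metis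
  show *: "\<sigma> x \<in> orbit \<sigma> m \<longleftrightarrow> x \<in> orbit \<sigma> m" for x
    using permutation_orbit_step[OF assms, of x] by (simp add: eq)
  show "inv \<sigma> x \<in> orbit \<sigma> m \<longleftrightarrow> x \<in> orbit \<sigma> m"
    using *[of "inv \<sigma> x"] assms by (simp add: permutation_inverse_works(2) permutation_bijective bij_inv_eq_iff surj_f_inv_f bij_is_surj)
qed

text \<open>The cycle of m is traversed backwards: each entry \<open>X i j\<close> becomes
  \<open>X j i\<close>, its conjugate for self-dual X, and conjugation also reverses the order of
  products. The orbits, hence the cycle maxima and the sign, stay the same, and the operation is an
  involution, which makes it suitable for pairing summands.\<close>

lemma reverse_cycle:
  assumes "\<sigma> permutes {..<n}"
  shows "reverse_cycle m \<sigma> permutes {..<n}"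
    and "orbit (reverse_cycle m \<sigma>) x = orbit \<sigma> x"
    and "reverse_cycle m (reverse_cycle m \<sigma>) = \<sigma>"
    and "x \<notin> orbit \<sigma> m \<Longrightarrow> cycle_product X (reverse_cycle m \<sigma>) x = cycle_product X \<sigma> x"
    and "(\<And>i j. X j i = cq_conj (X i j)) \<Longrightarrow>
           cycle_product X (reverse_cycle m \<sigma>) m = cq_conj (cycle_product X \<sigma> m)"
proof -
  note p = permutes_lessThan_permutation[OF assms]
  note invp = permutation_inverse[OF p]
  note step = orbit_step_iff[OF p]
  have inv1: "inv \<sigma> (\<sigma> x) = x" "\<sigma> (inv \<sigma> x) = x" for x
    using permutes_inverses[OF assms] by auto
  let ?r = "reverse_cycle m \<sigma>"
  have "inj ?r"
  proof (rule injI)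
    fix x y assume eq: "?r x = ?r y"
    have "?r z \<in> orbit \<sigma> m \<longleftrightarrow> z \<in> orbit \<sigma> m" for z by (simp add: reverse_cycle_def step)
    then have "x \<in> orbit \<sigma> m \<longleftrightarrow> y \<in> orbit \<sigma> m" using eq by metis
    then show "x = y" using eq inv1 by (auto simp: reverse_cycle_def split: if_splits) metis+
  qed
  moreover have "?r x = x" if "x \<notin> {..<n}" for x
    using that permutes_not_in[OF assms] permutes_not_in[OF permutes_inv[OF assms]]
    by (simp add: reverse_cycle_def)
  moreover have "surj ?r"
  proof (rule surjI)
    fix y show "?r (if y \<in> orbit \<sigma> m then \<sigma> y else inv \<sigma> y) = y"
      by (simp add: reverse_cycle_def step inv1)
  qed
  ultimately show rp: "?r permutes {..<n}"
    unfolding permutes_def by (metis injD surjD)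
  have out: "x \<notin> orbit \<sigma> m \<Longrightarrow> y \<in> orbit \<sigma> x \<Longrightarrow> ?r y = \<sigma> y" for x y
    using orbit_eq[OF p, of y m] orbit_eq[OF p, of y x] permutation_self_in_orbit[OF p]
    by (metis reverse_cycle_def)
  show "x \<notin> orbit \<sigma> m \<Longrightarrow> cycle_product X (reverse_cycle m \<sigma>) x = cycle_product X \<sigma> x"
    by (rule cycle_product_cong(1)[OF p]) (rule out)
  have ins: "orbit ?r x = orbit \<sigma> x" if "x \<in> orbit \<sigma> m" for x
  proof -
    have "?r y = inv \<sigma> y" if "y \<in> orbit (inv \<sigma>) x" for y
      using that \<open>x \<in> orbit \<sigma> m\<close> orbit_eq[OF p] orbit_inv_eq[OF p, of x] by (auto simp: reverse_cycle_def)
    then have "orbit ?r x = orbit (inv \<sigma>) x"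
      by (rule cycle_product_cong(2)[OF invp])
    then show ?thesis by (simp add: orbit_inv_eq[OF p])
  qed
  show orb: "orbit ?r x = orbit \<sigma> x" for x
  proof (cases "x \<in> orbit \<sigma> m")
    case False
    show ?thesis by (rule cycle_product_cong(2)[OF p]) (rule out[OF False])
  qed (rule ins)
  show "reverse_cycle m ?r = \<sigma>"
  proof
    fix x
    have "inv ?r x = \<sigma> x" if x: "x \<in> orbit \<sigma> m"
    proof (rule inv_f_eq[OF \<open>inj ?r\<close>])
      show "?r (\<sigma> x) = x" by (simp add: reverse_cycle_def step inv1 x)
    qed
    then show "reverse_cycle m ?r x = \<sigma> x"
      unfolding reverse_cycle_def[of m ?r] orb by (simp add: reverse_cycle_def)
  qed
  show "cycle_product X ?r m = cq_conj (cycle_product X \<sigma> m)" if dual: "\<And>i j. X j i = cq_conj (X i j)"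
  proof -
    define L where "L = least_power \<sigma> m"
    have L: "least_power ?r m = L" "(\<sigma> ^^ L) m = m"
      using least_power_eq_card_orbit[OF p] least_power_eq_card_orbit[OF permutes_lessThan_permutation[OF rp]]
        least_power_of_permutation[OF p] by (simp_all add: L_def orb)
    have pow: "i \<le> L \<Longrightarrow> (?r ^^ i) m = (\<sigma> ^^ (L - i)) m" for i
    proof (induction i)
      case (Suc i)
      have "(\<sigma> ^^ (L - i)) m \<in> orbit \<sigma> m"
        using orbit_altdef_permutation[OF p] by blast
      moreover have "(\<sigma> ^^ (L - i)) m = \<sigma> ((\<sigma> ^^ (L - Suc i)) m)"
        using Suc.prems by (metis Suc_diff_Suc Suc_le_lessD comp_apply funpow.simps(2))
      ultimately show ?case using Suc by (simp add: reverse_cycle_def inv1)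
    qed (simp add: L)
    have "cycle_product X ?r m = prod_list (map (\<lambda>i. X ((?r ^^ i) m) ((?r ^^ Suc i) m)) [0..<L])"
      by (simp only: cycle_product_altdef L)
    also have "map (\<lambda>i. X ((?r ^^ i) m) ((?r ^^ Suc i) m)) [0..<L]
        = rev (map cq_conj (map (\<lambda>i. X ((\<sigma> ^^ i) m) ((\<sigma> ^^ Suc i) m)) [0..<L]))"
    proof (rule nth_equalityI)
      fix i assume i: "i < length (map (\<lambda>i. X ((?r ^^ i) m) ((?r ^^ Suc i) m)) [0..<L])"
      then have i: "i < L" by simp
      \<comment> \<open>Step i of the reversed cycle leads from position L - i to position L - i - 1
        of the original one. It undoes the original step number L - 1 - i, which is entry i of the
        reversed list.\<close>
      then have e: "Suc (L - Suc i) = L - i" by simp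
      have a: "(?r ^^ i) m = (\<sigma> ^^ (L - i)) m" "(?r ^^ Suc i) m = (\<sigma> ^^ (L - Suc i)) m"
        using i by (intro pow, simp)+
      have "map (\<lambda>i. X ((?r ^^ i) m) ((?r ^^ Suc i) m)) [0..<L] ! i
          = X ((\<sigma> ^^ (L - i)) m) ((\<sigma> ^^ (L - Suc i)) m)"
        using i by (simp only: nth_map_upt length_upt a add_0 diff_zero)
      also have "\<dots> = rev (map cq_conj (map (\<lambda>i. X ((\<sigma> ^^ i) m) ((\<sigma> ^^ Suc i) m)) [0..<L])) ! i"
        using i e by (simp add: rev_nth dual[symmetric] del: funpow.simps)
      finally show "map (\<lambda>i. X ((?r ^^ i) m) ((?r ^^ Suc i) m)) [0..<L] ! i = \<dots>" .
    qed simp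
    finally show ?thesis
      by (simp only: cycle_product_altdef L_def cq_conj_prod_list)
  qed
qed


subsection \<open>The Moore-Dyson determinant of a self-dual matrix\<close>

lemma prod_list_map_filter_neutral:
  "prod_list (map h (filter Q xs)) = prod_list (map (\<lambda>x. if Q x then h x else (1::'b::monoid_mult)) xs)"
  by (induction xs) auto

text \<open>Padding with factors 1 makes the ordered product run over all indices n-1, ..., 0 for
  every permutation, so that index j has the same place in every summand.\<close>

lemma Det_M_altdef:
  "Det_M n X = (\<Sum>\<sigma> | \<sigma> permutes {..<n}. (- 1) ^ (n - card (set (cycle_maxima n \<sigma>))) *
     prod_list (map (\<lambda>m. if m \<in> set (cycle_maxima n \<sigma>) then cycle_product X \<sigma> m else 1) (rev [0..<n])))"
proof -
  have "prod_list (map (cycle_product X \<sigma>) (cycle_maxima n \<sigma>)) =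
      prod_list (map (\<lambda>m. if m \<in> set (cycle_maxima n \<sigma>) then cycle_product X \<sigma> m else 1) (rev [0..<n]))" for \<sigma>
    unfolding cycle_maxima_def prod_list_map_filter_neutral
    by (intro arg_cong[of _ _ prod_list] map_cong) auto
  then show ?thesis
    by (simp add: Det_M_def distinct_card[OF distinct_cycle_maxima])
qed

lemma cycle_maxima_reverse_cycle:
  assumes "\<sigma> permutes {..<n}"
  shows "cycle_maxima n (reverse_cycle m \<sigma>) = cycle_maxima n \<sigma>"
  unfolding cycle_maxima_def
  by (simp add: cycle_maximum_iff[OF permutes_lessThan_permutation] reverse_cycle[OF assms] assms
      cycle_maximum_iff[OF permutes_lessThan_permutation[OF assms]]
      cycle_maximum_iff[OF permutes_lessThan_permutation[OF reverse_cycle(1)[OF assms]]])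

text \<open>The factors of the cycles with maximum \<open>< j\<close> are replaced by their scalar parts, one value of
  \<open>j\<close> at a time: reversing the cycle with maximum \<open>j\<close> conjugates its factor and
  leaves everything else unchanged, and $q + q^*$ is twice the scalar part of $q$.\<close>

lemma Det_M_partially_scalar:
  assumes dual: "\<And>i j. X j i = cq_conj (X i j)" and "j \<le> n"
  shows "Det_M n X = (\<Sum>\<sigma> | \<sigma> permutes {..<n}. (- 1) ^ (n - card (set (cycle_maxima n \<sigma>))) *
     prod_list (map (\<lambda>m. if m \<in> set (cycle_maxima n \<sigma>) then
        (if m < j then cq_of_complex (cq_scalar (cycle_product X \<sigma> m)) else cycle_product X \<sigma> m)
        else 1) (rev [0..<n])))"
  using assms(2)
proof (induction j)
  case 0
  show ?case by (simp only: Det_M_altdef not_less_zero if_False)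
next
  case (Suc j)
  define T where "T \<sigma> = set (cycle_maxima n \<sigma>)" for \<sigma>
  define F where "F k \<sigma> = (\<lambda>m. if m \<in> T \<sigma> then
        (if m < k then cq_of_complex (cq_scalar (cycle_product X \<sigma> m)) else cycle_product X \<sigma> m)
        else 1)" for k \<sigma>
  define t where "t k = (\<lambda>\<sigma>. (- 1) ^ (n - card (T \<sigma>)) * prod_list (map (F k \<sigma>) (rev [0..<n])))" for k
  \<comment> \<open>If j is a cycle maximum, the permutation is paired with its reversal along that
    cycle; otherwise it is its own partner. This is an involution since reversal keeps the
    maxima.\<close>
  define \<iota> where "\<iota> \<sigma> = (if j \<in> T \<sigma> then reverse_cycle j \<sigma> else \<sigma>)" for \<sigma>
  let ?S = "{\<sigma>. \<sigma> permutes {..<n}}"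
  have T\<iota>: "T (\<iota> \<sigma>) = T \<sigma>" if "\<sigma> \<in> ?S" for \<sigma>
    using that by (simp add: T_def \<iota>_def cycle_maxima_reverse_cycle)
  have reindex: "sum (t j) ?S = (\<Sum>\<sigma>\<in>?S. t j (\<iota> \<sigma>))"
    by (rule sum.reindex_bij_witness[of _ \<iota> \<iota>])
      (auto simp: \<iota>_def T_def cycle_maxima_reverse_cycle reverse_cycle(1,3))
  have pair: "t j \<sigma> + t j (\<iota> \<sigma>) = t (Suc j) \<sigma> + t (Suc j) \<sigma>" if \<sigma>: "\<sigma> \<in> ?S" for \<sigma>
  proof -
    have p: "permutation \<sigma>" using permutes_lessThan_permutation \<sigma> by simp
    define a where "a = prod_list (map (F j \<sigma>) (rev [Suc j..<n]))"
    define b where "b = prod_list (map (F j \<sigma>) (rev [0..<j]))"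
    define s where "s = (- 1 :: cquat) ^ (n - card (T \<sigma>))"
    have split: "rev [0..<n] = rev [Suc j..<n] @ j # rev [0..<j]"
      using Suc.prems upt_add_eq_append[of 0 j "n - j"] upt_conv_Cons[of j n] by simp
    have eqS: "F (Suc j) \<sigma> m = F j \<sigma> m" if "m \<noteq> j" for m
      using that by (auto simp: F_def)
    have eq\<iota>: "F j (\<iota> \<sigma>) m = F j \<sigma> m" if "m \<noteq> j" for m
    proof (cases "m \<in> T \<sigma> \<and> j \<in> T \<sigma>")
      case True
      have "transversal n \<sigma> (T \<sigma>)" using transversal_cycle_maxima \<sigma> by (simp add: T_def)
      moreover have "j \<in> orbit \<sigma> j" by (rule permutation_self_in_orbit[OF p])
      ultimately have "m \<notin> orbit \<sigma> j"
        using True that transversal_unique[of n \<sigma> "T \<sigma>" j m j] Suc.prems by auto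
      then show ?thesis
        using T\<iota>[OF \<sigma>] \<sigma> by (simp add: F_def \<iota>_def reverse_cycle(4))
    qed (use T\<iota>[OF \<sigma>] in \<open>auto simp: F_def \<iota>_def\<close>)
    have t1: "t j \<sigma> = s * (a * (F j \<sigma> j * b))"
      unfolding t_def s_def split a_def b_def by simp
    have same: "map (F (Suc j) \<sigma>) xs = map (F j \<sigma>) xs" "map (F j (\<iota> \<sigma>)) xs = map (F j \<sigma>) xs" if "j \<notin> set xs" for xs
      using that eqS eq\<iota> by (metis map_cong)+
    have nj: "j \<notin> set (rev [Suc j..<n])" "j \<notin> set (rev [0..<j])" by auto
    have t2: "t (Suc j) \<sigma> = s * (a * (F (Suc j) \<sigma> j * b))"
      and t3: "t j (\<iota> \<sigma>) = s * (a * (F j (\<iota> \<sigma>) j * b))"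
      unfolding t_def s_def split a_def b_def T\<iota>[OF \<sigma>]
        map_append list.map prod_list.append prod_list.Cons
      by (simp_all only: same[OF nj(1)] same[OF nj(2)])
    \<comment> \<open>If j is a cycle maximum, this is the identity for q + q^* with q the cycle
      product; otherwise all four factors are 1.\<close>
    have mid: "F j \<sigma> j + F j (\<iota> \<sigma>) j = F (Suc j) \<sigma> j + F (Suc j) \<sigma> j"
      using T\<iota>[OF \<sigma>] \<sigma> by (simp add: F_def \<iota>_def reverse_cycle(5)[OF _ dual] cq_add_conj)
    have "s * (a * (u * b)) + s * (a * (v * b)) = s * (a * ((u + v) * b))" for u v
      by (simp only: distrib_left distrib_right)
    then show ?thesis
      unfolding t1 t2 t3 by (simp only: mid)
  qed
  have "sum (t j) ?S + sum (t j) ?S = (\<Sum>\<sigma>\<in>?S. t j \<sigma> + t j (\<iota> \<sigma>))"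
    by (subst (2) reindex) (simp add: sum.distrib)
  also have "\<dots> = sum (t (Suc j)) ?S + sum (t (Suc j)) ?S"
    unfolding sum.distrib[symmetric] by (rule sum.cong[OF refl pair])
  finally have "sum (t j) ?S = sum (t (Suc j)) ?S" by (rule cq_double_cancel)
  moreover have "Det_M n X = sum (t j) ?S"
    using Suc.IH[OF Suc_leD[OF Suc.prems]] by (simp only: t_def F_def T_def)
  ultimately show ?case by (simp only: t_def F_def T_def)
qed

text \<open>This is the last stage j = n of the replacement: all factors are central scalars, so the
  order of the cycles is immaterial and the noncommutative product becomes a product over a
  set.\<close>

lemma cq_scalar_Det_M:
  assumes dual: "\<And>i j. X j i = cq_conj (X i j)"
  shows "cq_scalar (Det_M n X) = (\<Sum>\<sigma> | \<sigma> permutes {..<n}.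
     (- 1) ^ (n - card (set (cycle_maxima n \<sigma>))) *
     (\<Prod>m\<in>set (cycle_maxima n \<sigma>). cq_scalar (cycle_product X \<sigma> m)))"
proof -
  have "(- 1) ^ k = cq_of_complex ((- 1) ^ k)" for k
    by (simp add: cq_of_complex_power cq_of_complex_minus)
  moreover have "prod_list (map (\<lambda>m. if m \<in> set (cycle_maxima n \<sigma>) then
        (if m < n then cq_of_complex (cq_scalar (cycle_product X \<sigma> m)) else cycle_product X \<sigma> m)
        else 1) (rev [0..<n]))
      = cq_of_complex (\<Prod>m\<in>set (cycle_maxima n \<sigma>). cq_scalar (cycle_product X \<sigma> m))" (is "prod_list (map ?f _) = _") for \<sigma>
  proof -
    have "map ?f (rev [0..<n]) = map (\<lambda>m. cq_of_complex (if m \<in> set (cycle_maxima n \<sigma>) then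
        cq_scalar (cycle_product X \<sigma> m) else 1)) (rev [0..<n])"
      by (rule map_cong) auto
    moreover have "prod_list (map h (rev [0..<n])) = (\<Prod>m<n. h m)" for h :: "nat \<Rightarrow> complex"
      by (simp add: prod.distinct_set_conv_list[symmetric] lessThan_atLeast0)
    moreover have "(\<Prod>m<n. if m \<in> set (cycle_maxima n \<sigma>) then h m else 1)
        = prod h (set (cycle_maxima n \<sigma>))" for h :: "nat \<Rightarrow> complex"
      by (rule prod.mono_neutral_cong_right) (auto simp: cycle_maxima_def)
    ultimately show ?thesis
      by (simp only: cq_of_complex_prod_list)
  qed
  ultimately show ?thesis
    by (subst Det_M_partially_scalar[OF dual order_refl]) (simp add: cq_scalar_sum)
qed

text \<open>Conjugating each permutation by \<open>\<pi>\<close> matches the cycle products of the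
  two matrices factor by factor. The cycle maxima go to representatives that need not be maximal,
  but scalar parts of cycle products do not depend on the representative.\<close>

lemma cq_scalar_Det_M_permute:
  assumes dual: "\<And>i j. X j i = cq_conj (X i j)" and \<pi>: "\<pi> permutes {..<n}"
  shows "cq_scalar (Det_M n (\<lambda>i j. X (\<pi> i) (\<pi> j))) = cq_scalar (Det_M n X)"
proof -
  define Y where "Y i j = X (\<pi> i) (\<pi> j)" for i j
  have dualY: "Y j i = cq_conj (Y i j)" for i j unfolding Y_def by (rule dual)
  have inv: "\<pi> (inv \<pi> x) = x" "inv \<pi> (\<pi> x) = x" for x
    using permutes_inverses[OF \<pi>] by auto
  have inj: "inv \<pi> x = inv \<pi> y \<longleftrightarrow> x = y" for x y by (metis inv)
  define c where "c \<sigma> = inv \<pi> \<circ> \<sigma> \<circ> \<pi>" for \<sigma>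
  have c_perm: "c \<sigma> permutes {..<n}" if "\<sigma> permutes {..<n}" for \<sigma>
    unfolding c_def by (intro permutes_compose \<pi> permutes_inv that)
  have pow: "(c \<sigma> ^^ k) (inv \<pi> m) = inv \<pi> ((\<sigma> ^^ k) m)" for \<sigma> k m
    by (induction k) (simp_all add: c_def inv)
  have orb: "orbit (c \<sigma>) (inv \<pi> m) = inv \<pi> ` orbit \<sigma> m" for \<sigma> m
    by (auto simp: orbit_altdef pow)
  have cp: "cycle_product Y (c \<sigma>) (inv \<pi> m) = cycle_product X \<sigma> m" for \<sigma> m
  proof -
    have "least_power (c \<sigma>) (inv \<pi> m) = least_power \<sigma> m"
      by (simp add: least_power_def pow inj)
    then show ?thesis by (simp only: cycle_product_altdef pow Y_def inv)
  qed
  have trans: "transversal n (c \<sigma>) (inv \<pi> ` set (cycle_maxima n \<sigma>))" if \<sigma>: "\<sigma> permutes {..<n}" for \<sigma>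
  proof -
    have T: "transversal n \<sigma> (set (cycle_maxima n \<sigma>))" by (rule transversal_cycle_maxima[OF \<sigma>])
    show ?thesis
      unfolding transversal_def
    proof (intro conjI allI impI)
      show "inv \<pi> ` set (cycle_maxima n \<sigma>) \<subseteq> {..<n}"
        using T permutes_in_image[OF permutes_inv[OF \<pi>]] by (auto simp: transversal_def)
      fix x assume "x < n"
      then have "\<pi> x < n" using permutes_in_image[OF \<pi>] by auto
      then obtain t where t: "t \<in> set (cycle_maxima n \<sigma>)" "t \<in> orbit \<sigma> (\<pi> x)"
        and uniq: "\<And>s. s \<in> set (cycle_maxima n \<sigma>) \<Longrightarrow> s \<in> orbit \<sigma> (\<pi> x) \<Longrightarrow> s = t"
        using T unfolding transversal_def by metis
      have "orbit (c \<sigma>) x = inv \<pi> ` orbit \<sigma> (\<pi> x)" using orb[of \<sigma> "\<pi> x"] by (simp add: inv)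
      then have mem: "inv \<pi> s \<in> inv \<pi> ` set (cycle_maxima n \<sigma>) \<and> inv \<pi> s \<in> orbit (c \<sigma>) x \<longleftrightarrow>
          s \<in> set (cycle_maxima n \<sigma>) \<and> s \<in> orbit \<sigma> (\<pi> x)" for s
        by (simp add: image_iff inj)
      show "\<exists>!t. t \<in> inv \<pi> ` set (cycle_maxima n \<sigma>) \<and> t \<in> orbit (c \<sigma>) x"
      proof (rule ex1I)
        show "inv \<pi> t \<in> inv \<pi> ` set (cycle_maxima n \<sigma>) \<and> inv \<pi> t \<in> orbit (c \<sigma>) x"
          unfolding mem using t by (rule conjI)
        fix u assume u: "u \<in> inv \<pi> ` set (cycle_maxima n \<sigma>) \<and> u \<in> orbit (c \<sigma>) x"
        then obtain s where s: "u = inv \<pi> s" by blast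
        have "s = t" using u uniq[of s] unfolding s mem by (rule_tac conjE)
        then show "u = inv \<pi> t" unfolding s by (rule arg_cong)
      qed
    qed
  qed
  define g where "g Z \<sigma> = (- 1) ^ (n - card (set (cycle_maxima n \<sigma>))) *
     (\<Prod>m\<in>set (cycle_maxima n \<sigma>). cq_scalar (cycle_product Z \<sigma> m))" for Z \<sigma>
  have "g Y (c \<sigma>) = g X \<sigma>" if \<sigma>: "\<sigma> permutes {..<n}" for \<sigma>
  proof -
    note p = permutes_lessThan_permutation[OF c_perm[OF \<sigma>]]
    note tr = transversal_prod[OF p transversal_cycle_maxima[OF c_perm[OF \<sigma>]] trans[OF \<sigma>]]
    have "card (set (cycle_maxima n (c \<sigma>))) = card (inv \<pi> ` set (cycle_maxima n \<sigma>))"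
      by (rule tr(2)[where h = "\<lambda>_. 1"]) simp
    moreover have "(\<Prod>m\<in>set (cycle_maxima n (c \<sigma>)). cq_scalar (cycle_product Y (c \<sigma>) m)) =
        (\<Prod>m\<in>inv \<pi> ` set (cycle_maxima n \<sigma>). cq_scalar (cycle_product Y (c \<sigma>) m))"
      by (rule tr(1)) (rule cq_scalar_cycle_product_orbit[OF p])
    moreover have "inj_on (inv \<pi>) A" for A by (simp add: inj inj_on_def)
    ultimately show ?thesis
      by (simp add: g_def prod.reindex card_image cp)
  qed
  then have "sum (g X) {\<sigma>. \<sigma> permutes {..<n}} = sum (g Y) {\<sigma>. \<sigma> permutes {..<n}}"
    by (intro sum.reindex_bij_witness[of _ "\<lambda>\<tau>. \<pi> \<circ> \<tau> \<circ> inv \<pi>" c])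
      (auto simp: c_perm, auto simp: c_def fun_eq_iff inv intro!: permutes_compose \<pi> permutes_inv)
  then show ?thesis
    unfolding cq_scalar_Det_M[of X, OF dual] Y_def[symmetric] cq_scalar_Det_M[of Y, OF dualY]
    by (simp add: g_def)
qed

text \<open>Along a cycle every point occurs once as a row index and once as a column index, and the
  scalars are central.\<close>

lemma cycle_product_scale:
  assumes "permutation \<sigma>"
  shows "cycle_product (\<lambda>i j. cq_of_complex (a i) * X i j * cq_of_complex (a j)) \<sigma> m =
    cq_of_complex (\<Prod>i\<in>orbit \<sigma> m. (a i)\<^sup>2) * cycle_product X \<sigma> m"
proof -
  define L where "L = least_power \<sigma> m"
  have L: "(\<sigma> ^^ L) m = m" using least_power_of_permutation[OF assms] by (simp add: L_def)
  have "prod_list (map (\<lambda>i. cq_of_complex (a ((\<sigma> ^^ i) m)) * X ((\<sigma> ^^ i) m) ((\<sigma> ^^ Suc i) m)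
        * cq_of_complex (a ((\<sigma> ^^ Suc i) m))) [0..<k])
      = cq_of_complex ((\<Prod>i<k. a ((\<sigma> ^^ i) m)) * (\<Prod>i<k. a ((\<sigma> ^^ Suc i) m))) *
        prod_list (map (\<lambda>i. X ((\<sigma> ^^ i) m) ((\<sigma> ^^ Suc i) m)) [0..<k])" (is "?l k = cq_of_complex (?p k) * ?r k") for k
  proof (induction k)
    case (Suc k)
    define u v where "u = a ((\<sigma> ^^ k) m)" and "v = a ((\<sigma> ^^ Suc k) m)"
    define x where "x = X ((\<sigma> ^^ k) m) ((\<sigma> ^^ Suc k) m)"
    have "cq_of_complex u * x * cq_of_complex v = cq_of_complex (u * v) * x"
      unfolding cq_of_complex_mult mult.assoc cq_of_complex_central[of v x, symmetric] ..
    then have "?l (Suc k) = cq_of_complex (?p k) * ?r k * (cq_of_complex (u * v) * x)"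
      using Suc by (simp add: u_def v_def x_def)
    also have "\<dots> = cq_of_complex (?p k * (u * v)) * (?r k * x)"
      by (rule cq_mult_of_complex)
    also have "?p k * (u * v) = ?p (Suc k)"
      by (simp add: u_def v_def mult_ac)
    also have "?r k * x = ?r (Suc k)"
      by (simp add: x_def)
    finally show ?case .
  qed simp
  from this[of L] have "cycle_product (\<lambda>i j. cq_of_complex (a i) * X i j * cq_of_complex (a j)) \<sigma> m =
      cq_of_complex ((\<Prod>i<L. a ((\<sigma> ^^ i) m)) * (\<Prod>i<L. a ((\<sigma> ^^ Suc i) m))) * cycle_product X \<sigma> m"
    by (simp only: cycle_product_altdef L_def)
  \<comment> \<open>Shifting by one step moves the factor at m from the front to the end, where the
    cycle closes up.\<close>
  also have "(\<Prod>i<L. a ((\<sigma> ^^ Suc i) m)) = (\<Prod>i<L. a ((\<sigma> ^^ i) m))"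
  proof (cases L)
    case (Suc k)
    have "(\<Prod>i<L. a ((\<sigma> ^^ Suc i) m)) = (\<Prod>i<k. a ((\<sigma> ^^ Suc i) m)) * a m"
      using L by (simp add: Suc del: funpow.simps)
    also have "\<dots> = (\<Prod>i<L. a ((\<sigma> ^^ i) m))"
      by (simp add: Suc prod.lessThan_Suc_shift mult.commute del: funpow.simps(2) prod.lessThan_Suc)
    finally show ?thesis .
  qed simp
  also have "(\<Prod>i<L. a ((\<sigma> ^^ i) m)) = (\<Prod>i\<in>orbit \<sigma> m. a i)"
  proof -
    have "inj_on (\<lambda>i. (\<sigma> ^^ i) m) {..<L}"
      using cycle_of_permutation[OF assms, of m] by (simp add: L_def distinct_map lessThan_atLeast0)
    moreover have "(\<lambda>i. (\<sigma> ^^ i) m) ` {..<L} = orbit \<sigma> m"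
      unfolding set_support[OF assms, symmetric] by (simp add: L_def lessThan_atLeast0)
    ultimately show ?thesis by (metis prod.reindex_cong)
  qed
  finally show ?thesis by (simp add: power2_eq_square prod.distrib)
qed

text \<open>The cycles partition \<open>{..<n}\<close>, so the scalars collected from all cycles
  multiply to the same product for every permutation.\<close>

lemma Det_M_scale:
  "Det_M n (\<lambda>i j. cq_of_complex (a i) * X i j * cq_of_complex (a j)) =
    cq_of_complex (\<Prod>i<n. (a i)\<^sup>2) * Det_M n X"
  unfolding Det_M_def sum_distrib_left
proof (rule sum.cong)
  fix \<sigma> assume "\<sigma> \<in> {\<sigma>. \<sigma> permutes {..<n}}"
  then have \<sigma>: "\<sigma> permutes {..<n}" by simp
  note p = permutes_lessThan_permutation[OF \<sigma>]
  define Y where "Y i j = cq_of_complex (a i) * X i j * cq_of_complex (a j)" for i j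
  define ms where "ms = cycle_maxima n \<sigma>"
  define h where "h m = (\<Prod>i\<in>orbit \<sigma> m. (a i)\<^sup>2)" for m
  have "prod_list (map (cycle_product Y \<sigma>) xs) =
      cq_of_complex (prod_list (map h xs)) * prod_list (map (cycle_product X \<sigma>) xs)" for xs
  proof (induction xs)
    case (Cons x xs)
    have "cycle_product Y \<sigma> x = cq_of_complex (h x) * cycle_product X \<sigma> x"
      unfolding Y_def h_def by (rule cycle_product_scale[OF p])
    then show ?case
      using Cons by (simp add: cq_mult_of_complex)
  qed simp
  moreover have "prod_list (map h ms) = (\<Prod>i<n. (a i)\<^sup>2)"
  proof -
    have T: "transversal n \<sigma> (set ms)" unfolding ms_def by (rule transversal_cycle_maxima[OF \<sigma>])
    have "prod_list (map h ms) = prod h (set ms)"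
      by (simp add: prod.distinct_set_conv_list ms_def distinct_cycle_maxima)
    also have "\<dots> = prod (\<lambda>i. (a i)\<^sup>2) (\<Union>m\<in>set ms. orbit \<sigma> m)"
      unfolding h_def
    proof (rule prod.UNION_disjoint[symmetric])
      have sub: "orbit \<sigma> m \<subseteq> {..<n}" if "m \<in> set ms" for m
        using T that permutes_orbit_subset[OF \<sigma>] by (auto simp: transversal_def)
      show "\<forall>m\<in>set ms. finite (orbit \<sigma> m)" using sub finite_subset by blast
      show "\<forall>i\<in>set ms. \<forall>j\<in>set ms. i \<noteq> j \<longrightarrow> orbit \<sigma> i \<inter> orbit \<sigma> j = {}"
      proof (intro ballI impI equals0I)
        fix i j x assume *: "i \<in> set ms" "j \<in> set ms" "i \<noteq> j" "x \<in> orbit \<sigma> i \<inter> orbit \<sigma> j"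
        then have "x < n" "i \<in> orbit \<sigma> x" "j \<in> orbit \<sigma> x"
          using sub[of i] orbit_eq[OF p, of x] permutation_self_in_orbit[OF p] by auto
        then show False using transversal_unique[OF T] * by blast
      qed
    qed simp
    also have "(\<Union>m\<in>set ms. orbit \<sigma> m) = {..<n}"
    proof
      show "(\<Union>m\<in>set ms. orbit \<sigma> m) \<subseteq> {..<n}"
        using T permutes_orbit_subset[OF \<sigma>] by (force simp: transversal_def)
      show "{..<n} \<subseteq> (\<Union>m\<in>set ms. orbit \<sigma> m)"
      proof
        fix x assume "x \<in> {..<n}"
        then obtain t where "t \<in> set ms" "t \<in> orbit \<sigma> x" using T by (auto simp: transversal_def)
        then show "x \<in> (\<Union>m\<in>set ms. orbit \<sigma> m)"
          using orbit_eq[OF p, of t x] permutation_self_in_orbit[OF p, of x] by auto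
      qed
    qed
    finally show ?thesis .
  qed
  ultimately show "(- 1) ^ (n - length (cycle_maxima n \<sigma>)) * prod_list (map (cycle_product
        (\<lambda>i j. cq_of_complex (a i) * X i j * cq_of_complex (a j)) \<sigma>) (cycle_maxima n \<sigma>)) =
      cq_of_complex (\<Prod>i<n. (a i)\<^sup>2) * ((- 1) ^ (n - length (cycle_maxima n \<sigma>)) *
        prod_list (map (cycle_product X \<sigma>) (cycle_maxima n \<sigma>)))"
    unfolding Y_def ms_def by (simp add: cq_mult_of_complex_left)
qed simp

subsection \<open>Falling factorials\<close>

text \<open>Truncated subtraction is harmless here: for k > N the factor with j = N is 0.\<close>

definition falling :: "nat \<Rightarrow> nat \<Rightarrow> nat" where
  "falling N k = (\<Prod>j<k. N - j)"

lemma falling_0 [simp]: "falling N 0 = 1"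
  by (simp add: falling_def)

lemma falling_Suc: "falling N (Suc k) = N * falling (N - 1) k"
  unfolding falling_def prod.lessThan_Suc_shift by simp

definition letter_count :: "nat \<Rightarrow> (nat \<Rightarrow> nat) \<Rightarrow> nat \<Rightarrow> nat" where
  "letter_count n w i = card {j. j < n \<and> w j = i}"

text \<open>Think of \<open>N i\<close> points of weight \<open>c i\<close> for each i. A word
  prescribes the block of each of n selected points in order, and the falling factorials count the
  selections without repetition. The sum is thus n! times the n-th elementary symmetric polynomial
  of the weights.\<close>

definition falling_word_sum ::
  "(nat \<Rightarrow> 'a::comm_semiring_1) \<Rightarrow> nat \<Rightarrow> nat \<Rightarrow> (nat \<Rightarrow> nat) \<Rightarrow> 'a" where
  "falling_word_sum c m n N = (\<Sum>w\<in>{..<n} \<rightarrow>\<^sub>E {..<m}.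
     (\<Prod>j<n. c (w j)) * of_nat (\<Prod>i<m. falling (N i) (letter_count n w i)))"

lemma falling_word_sum_0 [simp]: "falling_word_sum c m 0 N = 1"
  by (simp add: falling_word_sum_def letter_count_def)

lemma letter_count_fun_upd:
  "letter_count (Suc n) (w(n := i)) l = (if l = i then Suc (letter_count n w l) else letter_count n w l)"
proof -
  have "{j. j < Suc n \<and> (w(n := i)) j = l} =
      (if l = i then insert n {j. j < n \<and> w j = l} else {j. j < n \<and> w j = l})"
    by (auto simp: less_Suc_eq)
  then show ?thesis by (simp add: letter_count_def)
qed

text \<open>Select the point in the last position first: block i offers \<open>N i\<close> choices
  of weight \<open>c i\<close>, after which one point of that block is used up.\<close>

lemma falling_word_sum_Suc:
  "falling_word_sum c m (Suc n) N =
     (\<Sum>i<m. c i * of_nat (N i) * falling_word_sum c m n (N(i := N i - 1)))"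
proof -
  define g where "g w = (\<Prod>j<Suc n. c (w j)) * of_nat (\<Prod>i<m. falling (N i) (letter_count (Suc n) w i))" for w
  have "falling_word_sum c m (Suc n) N = sum g (insert n {..<n} \<rightarrow>\<^sub>E {..<m})"
    by (simp add: falling_word_sum_def g_def lessThan_Suc)
  also have "\<dots> = (\<Sum>(i, w)\<in>{..<m} \<times> ({..<n} \<rightarrow>\<^sub>E {..<m}). g (w(n := i)))"
    unfolding PiE_insert_eq
    by (subst sum.reindex[OF inj_combinator]) (simp_all add: case_prod_unfold)
  also have "\<dots> = (\<Sum>i<m. \<Sum>w\<in>{..<n} \<rightarrow>\<^sub>E {..<m}. g (w(n := i)))"
    by (simp add: sum.cartesian_product)
  also have "\<dots> = (\<Sum>i<m. c i * of_nat (N i) * falling_word_sum c m n (N(i := N i - 1)))"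
  proof (rule sum.cong)
    fix i assume i: "i \<in> {..<m}"
    have "g (w(n := i)) = c i * of_nat (N i) * ((\<Prod>j<n. c (w j)) *
        of_nat (\<Prod>l<m. falling ((N(i := N i - 1)) l) (letter_count n w l)))" for w
    proof -
      have "(\<Prod>l<m. falling (N l) (letter_count (Suc n) (w(n := i)) l)) =
          N i * (\<Prod>l<m. falling ((N(i := N i - 1)) l) (letter_count n w l))"
        using i by (simp add: prod.remove[of _ i] letter_count_fun_upd falling_Suc)
      then show ?thesis by (simp add: g_def mult_ac)
    qed
    then show "(\<Sum>w\<in>{..<n} \<rightarrow>\<^sub>E {..<m}. g (w(n := i))) =
        c i * of_nat (N i) * falling_word_sum c m n (N(i := N i - 1))"
      by (simp add: falling_word_sum_def sum_distrib_left)
  qed simp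
  finally show ?thesis .
qed

text \<open>One further point joins block i. Selections avoiding it give the first summand; those
  using it put it in one of n + 1 positions and choose n old points for the rest. The induction
  reaches this through the recursion on the last letter.\<close>

lemma falling_word_sum_incr:
  assumes "i < m"
  shows "falling_word_sum c m (Suc n) (N(i := Suc (N i))) =
    falling_word_sum c m (Suc n) N + of_nat (Suc n) * c i * falling_word_sum c m n N"
proof (induction n arbitrary: N)
  case 0
  have "(\<Sum>l<m. c l * of_nat ((N(i := Suc (N i))) l)) = (\<Sum>l<m. c l * of_nat (N l) + (if l = i then c i else 0))"
    by (rule sum.cong) (auto simp: algebra_simps)
  then show ?case
    using assms by (simp add: falling_word_sum_Suc sum.distrib)
next
  case (Suc n)
  define M where "M l = N(l := N l - 1)" for l
  let ?V = "falling_word_sum c m"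
  let ?N = "N(i := Suc (N i))"
  have step: "c l * of_nat (?N l) * ?V (Suc n) (?N(l := ?N l - 1)) =
      c l * of_nat (N l) * ?V (Suc n) (M l) + of_nat (Suc n) * c i * (c l * of_nat (N l) * ?V n (M l))
      + (if l = i then c i * ?V (Suc n) N else 0)" for l
  proof (cases "l = i")
    case True
    have "of_nat (N i) * ?V (Suc n) N =
        of_nat (N i) * (?V (Suc n) (M i) + of_nat (Suc n) * c i * ?V n (M i))"
    \<comment> \<open>For \<open>N i\<close> = 0 truncation makes \<open>M i\<close> equal to N and
      the induction hypothesis does not help, but then both sides have the factor
      \<open>N i\<close>.\<close>
    proof (cases "N i")
      case (Suc k)
      then have "(M i)(i := Suc (M i i)) = N" by (auto simp: M_def)
      then show ?thesis using Suc.IH[of "M i"] by simp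
    qed simp
    then have "c i * (of_nat (N i) * ?V (Suc n) N) =
        c i * (of_nat (N i) * (?V (Suc n) (M i) + of_nat (Suc n) * c i * ?V n (M i)))"
      by simp
    then show ?thesis using True by (simp add: algebra_simps)
  next
    case False
    then have upd: "?N(l := ?N l - 1) = (M l)(i := Suc (M l i))"
      by (auto simp: M_def)
    show ?thesis unfolding upd Suc.IH using False by (simp add: algebra_simps)
  qed
  have "?V (Suc (Suc n)) ?N = (\<Sum>l<m. c l * of_nat (?N l) * ?V (Suc n) (?N(l := ?N l - 1)))"
    by (rule falling_word_sum_Suc)
  also have "\<dots> = ?V (Suc (Suc n)) N + of_nat (Suc n) * c i * ?V (Suc n) N + c i * ?V (Suc n) N"
    unfolding step sum.distrib sum_distrib_left[symmetric]
    using assms by (simp add: falling_word_sum_Suc M_def)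
  also have "\<dots> = ?V (Suc (Suc n)) N + of_nat (Suc (Suc n)) * c i * ?V (Suc n) N"
    by (simp add: algebra_simps)
  finally show ?case .
qed

text \<open>The summands are the elementary symmetric polynomials of the multiset in which \<open>c i\<close>
  occurs \<open>N i\<close> times.\<close>

lemma falling_word_sum_sums:
  fixes c :: "nat \<Rightarrow> 'a::real_normed_field"
  shows "(\<lambda>n. falling_word_sum c m n N / fact n) sums (\<Prod>i<m. (1 + c i) ^ N i)"
proof (induction "\<Sum>i<m. N i" arbitrary: N)
  case 0
  then have "falling_word_sum c m (Suc n) N = 0" "(\<Prod>i<m. (1 + c i) ^ N i) = 1" for n
    by (simp_all add: falling_word_sum_Suc)
  then have "falling_word_sum c m n N / fact n = (if n = 0 then \<Prod>i<m. (1 + c i) ^ N i else 0)" for n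
    by (cases n) simp_all
  then show ?case using sums_single[of 0 "\<lambda>_. \<Prod>i<m. (1 + c i) ^ N i"] by simp
next
  case (Suc s)
  then obtain i where i: "i < m" "N i \<noteq> 0"
    by (metis Zero_not_Suc lessThan_iff sum.neutral)
  define M where "M = N(i := N i - 1)"
  have N: "N = M(i := Suc (M i))" using i by (auto simp: M_def)
  have "sum N {..<m} = Suc (sum M {..<m})"
    using i by (simp add: N sum.remove[of _ i])
  then have "s = sum M {..<m}" using Suc.hyps(2) by simp
  define P where "P = (\<Prod>i<m. (1 + c i) ^ M i)"
  define a where "a = (\<lambda>n. falling_word_sum c m n M / fact n)"
  have "a sums P" using Suc.hyps(1)[OF \<open>s = _\<close>] by (simp add: a_def P_def)
  \<comment> \<open>For elementary symmetric polynomials, e_n(N) = e_n(M) + c_i e_(n-1)(M), where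
    e_(-1) is read as 0. On the sums of the series this is multiplication by 1 + c_i.\<close>
  moreover from this have "(\<lambda>n. c i * (if n = 0 then 0 else a (n - 1))) sums (c i * P)"
    using sums_Suc_iff[of "\<lambda>n. if n = 0 then 0 else a (n - 1)" P] by (intro sums_mult) simp
  ultimately have "(\<lambda>n. a n + c i * (if n = 0 then 0 else a (n - 1))) sums (P + c i * P)"
    by (rule sums_add)
  moreover have "falling_word_sum c m n N / fact n = a n + c i * (if n = 0 then 0 else a (n - 1))" for n
  proof (cases n)
    case (Suc k)
    have "of_nat (Suc k) * x / fact (Suc k) = x / fact k" for x :: 'a
      by (simp add: field_simps del: of_nat_Suc)
    from this[of "c i * falling_word_sum c m k M"] show ?thesis
      using falling_word_sum_incr[OF i(1), of c k M]
      by (simp add: Suc N[symmetric] a_def add_divide_distrib mult.assoc del: of_nat_Suc fact_Suc)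
  qed (simp add: a_def)
  moreover have "(\<Prod>i<m. (1 + c i) ^ N i) = P + c i * P"
    using i(1) by (simp add: P_def N prod.remove[of _ i] algebra_simps)
  ultimately show ?case by simp
qed

subsection \<open>Counts of points\<close>

text \<open>Exponents have to be natural numbers. Rounding \<open>num_points\<close>, rather than
  summing multiplicities, makes the measurability of the count immediate. An infinite count becomes
  0, so the value is meaningful only where counts are finite.\<close>

definition point_count :: "'a config \<Rightarrow> 'a set \<Rightarrow> nat" where
  "point_count \<xi> A = nat \<lfloor>enn2real (num_points \<xi> A)\<rfloor>"

text \<open>Every point counts at least 1, so a finite count leaves only finitely many points in A
  and the integral becomes a finite sum.\<close>

lemma num_points_finite:
  assumes "num_points \<xi> A < \<infinity>"
  shows "finite {x \<in> A. \<xi> x > 0}"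
    and "point_count \<xi> A = (\<Sum>x | x \<in> A \<and> \<xi> x > 0. \<xi> x)"
    and "num_points \<xi> A = of_nat (point_count \<xi> A)"
proof -
  define S where "S = {x. x \<in> A \<and> \<xi> x > 0}"
  have eq: "num_points \<xi> A = (\<integral>\<^sup>+x. of_nat (\<xi> x) * indicator A x \<partial>count_space UNIV)"
    by (simp add: num_points_def)
  have ge1: "1 \<le> (of_nat k :: ennreal)" if "k > 0" for k
    using of_nat_mono[of 1 k] that by simp
  have "emeasure (count_space UNIV) S = (\<integral>\<^sup>+x. indicator S x \<partial>count_space UNIV)"
    by simp
  also have "\<dots> \<le> num_points \<xi> A"
    unfolding eq by (intro nn_integral_mono) (simp add: S_def indicator_def ge1)
  finally have "emeasure (count_space UNIV) S < \<infinity>"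
    using assms by (rule order.strict_trans1)
  then have finS: "finite S"
    by (cases "finite S") simp_all
  then show "finite {x \<in> A. \<xi> x > 0}"
    by (simp add: S_def)
  have pos: "{x \<in> UNIV. 0 < of_nat (\<xi> x) * (indicator A x :: ennreal)} = S"
  proof -
    have "0 < (of_nat k :: ennreal) \<longleftrightarrow> k > 0" for k
      using ge1[of k] by (cases "k = 0") (simp_all add: less_le_trans[OF zero_less_one])
    then show ?thesis by (simp add: S_def indicator_def set_eq_iff)
  qed
  have "num_points \<xi> A = (\<Sum>x\<in>S. of_nat (\<xi> x) * indicator A x)"
    using nn_integral_count_space[of UNIV "\<lambda>x. of_nat (\<xi> x) * (indicator A x :: ennreal)"] finS
    unfolding eq pos by simp
  also have "\<dots> = of_nat (\<Sum>x\<in>S. \<xi> x)"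
    unfolding of_nat_sum by (rule sum.cong) (auto simp: S_def)
  finally have num: "num_points \<xi> A = of_nat (\<Sum>x\<in>S. \<xi> x)" .
  then show pc: "point_count \<xi> A = (\<Sum>x | x \<in> A \<and> \<xi> x > 0. \<xi> x)"
    by (simp add: point_count_def S_def ennreal_of_nat_eq_real_of_nat del: of_nat_sum)
  show "num_points \<xi> A = of_nat (point_count \<xi> A)"
    unfolding pc using num by (simp add: S_def)
qed

lemma falling_ennreal: "(\<Prod>j<k. (of_nat N :: ennreal) - of_nat j) = of_nat (falling N k)"
proof -
  have "(of_nat N :: ennreal) - of_nat j = of_nat (N - j)" for j
    by (cases "j \<le> N") (simp_all add: ennreal_of_nat_eq_real_of_nat ennreal_minus ennreal_neg of_nat_diff)
  then show ?thesis by (simp add: falling_def)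
qed

lemma sum_indicator_disjoint:
  fixes c :: "nat \<Rightarrow> 'b::semiring_1"
  assumes "disjoint_family_on A {..<m}" "i < m" "x \<in> A i"
  shows "(\<Sum>l<m. c l * indicator (A l) x) = c i"
proof -
  have "(\<Sum>l<m. c l * indicator (A l) x) = (\<Sum>l<m. if l = i then c i else 0)"
    using assms by (intro sum.cong) (auto simp: disjoint_family_on_def indicator_def)
  then show ?thesis using assms by simp
qed

lemma sum_indicator_outside:
  fixes c :: "nat \<Rightarrow> 'b::semiring_1"
  assumes "\<forall>i<m. x \<notin> A i"
  shows "(\<Sum>l<m. c l * indicator (A l) x) = 0"
  using assms by (intro sum.neutral) (auto simp: indicator_def)

text \<open>The points are grouped by block. The product is restricted to nonzero \<open>g x\<close>
  because the configuration may be infinite, and since no \<open>c i\<close> is 0 these are exactly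
  the points in the blocks. The map \<open>\<phi>\<close> is general in order to serve both 1 + z
  and 1 + |z|.\<close>

lemma prod_step_function:
  fixes c :: "nat \<Rightarrow> complex" and \<phi> :: "complex \<Rightarrow> 'b::comm_monoid_mult"
  assumes disj: "disjoint_family_on A {..<m}" and c: "\<And>i. i < m \<Longrightarrow> c i \<noteq> 0"
    and fin: "\<And>i. i < m \<Longrightarrow> num_points \<xi> (A i) < \<infinity>"
    and g: "\<And>x. g x = (\<Sum>i<m. c i * indicator (A i) x)"
  shows "finite {x. \<xi> x > 0 \<and> g x \<noteq> 0}"
    and "(\<Prod>x | \<xi> x > 0 \<and> g x \<noteq> 0. \<phi> (g x) ^ \<xi> x) = (\<Prod>i<m. \<phi> (c i) ^ point_count \<xi> (A i))"
proof -
  define S where "S i = {x \<in> A i. \<xi> x > 0}" for i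
  have finS: "finite (S i)" if "i < m" for i
    using num_points_finite(1)[OF fin[OF that]] by (simp add: S_def)
  have gA: "g x = c i" if "i < m" "x \<in> A i" for i x
    unfolding g by (rule sum_indicator_disjoint[OF disj that])
  have ex: "\<exists>i<m. x \<in> A i" if "g x \<noteq> 0" for x
    using that sum_indicator_outside[of m x A c] unfolding g by blast
  have UN: "{x. \<xi> x > 0 \<and> g x \<noteq> 0} = (\<Union>i<m. S i)"
  proof
    show "{x. \<xi> x > 0 \<and> g x \<noteq> 0} \<subseteq> (\<Union>i<m. S i)"
      using ex by (auto simp: S_def)
    show "(\<Union>i<m. S i) \<subseteq> {x. \<xi> x > 0 \<and> g x \<noteq> 0}"
      using gA c by (auto simp: S_def)
  qed
  show "finite {x. \<xi> x > 0 \<and> g x \<noteq> 0}"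
    unfolding UN using finS by auto
  have "(\<Prod>x | \<xi> x > 0 \<and> g x \<noteq> 0. \<phi> (g x) ^ \<xi> x) = (\<Prod>i<m. \<Prod>x\<in>S i. \<phi> (g x) ^ \<xi> x)"
    unfolding UN using finS disj
    by (intro prod.UNION_disjoint) (auto simp: S_def disjoint_family_on_def)
  also have "\<dots> = (\<Prod>i<m. \<phi> (c i) ^ point_count \<xi> (A i))"
  proof (rule prod.cong)
    fix i assume "i \<in> {..<m}"
    then have "(\<Prod>x\<in>S i. \<phi> (g x) ^ \<xi> x) = (\<Prod>x\<in>S i. \<phi> (c i) ^ \<xi> x)"
      using gA by (intro prod.cong) (auto simp: S_def)
    also have "\<dots> = \<phi> (c i) ^ point_count \<xi> (A i)"
      using num_points_finite(2)[OF fin[of i]] \<open>i \<in> _\<close> by (simp add: power_sum S_def)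
    finally show "(\<Prod>x\<in>S i. \<phi> (g x) ^ \<xi> x) = \<phi> (c i) ^ point_count \<xi> (A i)" .
  qed simp
  finally show "(\<Prod>x | \<xi> x > 0 \<and> g x \<noteq> 0. \<phi> (g x) ^ \<xi> x) = (\<Prod>i<m. \<phi> (c i) ^ point_count \<xi> (A i))" .
qed

lemma suminf_ennreal_finite:
  fixes a :: "nat \<Rightarrow> ennreal"
  assumes "(\<Sum>n. a n) < \<infinity>"
  shows "a n < \<infinity>" "summable (\<lambda>n. enn2real (a n))"
proof -
  have fin: "a n < \<infinity>" for n
    using sum_le_suminf[of a "{n}"] assms by (auto simp: summableI less_le_trans order.strict_trans1)
  then show "a n < \<infinity>" .
  have "a = (\<lambda>n. ennreal (enn2real (a n)))"
    using fin by (simp add: fun_eq_iff)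
  then show "summable (\<lambda>n. enn2real (a n))"
    using assms by (intro summable_suminf_not_top) (auto simp: less_top)
qed

text \<open>This is what the analytic part uses of the field: nonnegative densities whose integral
  over a product of blocks, in the order given by any word, is a factorial moment. For n = 0 the
  identity normalises \<open>R 0\<close> to 1 on the one-point space.\<close>

locale symmetric_correlations =
  fixes M :: "'a::topological_space measure" and P :: "'a config measure"
    and R :: "nat \<Rightarrow> (nat \<Rightarrow> 'a) \<Rightarrow> real"
  assumes sets_M: "sets M = sets borel"
    and field: "random_point_field P"
    and R_measurable [measurable]: "\<And>n. R n \<in> borel_measurable (Pi\<^sub>M {..<n} (\<lambda>_. M))"
    and R_nonneg: "\<And>n x. 0 \<le> R n x"
    and correlation: "\<And>n m A w. (\<And>i. i < m \<Longrightarrow> A i \<in> sets M) \<Longrightarrow> disjoint_family_on A {..<m} \<Longrightarrow>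
      w \<in> {..<n} \<rightarrow> {..<m} \<Longrightarrow>
      (\<integral>\<^sup>+\<xi>. (\<Prod>i<m. \<Prod>j<letter_count n w i. num_points \<xi> (A i) - of_nat j) \<partial>P) =
      (\<integral>\<^sup>+x. (\<Prod>j<n. indicator (A (w j)) (x j)) * ennreal (R n x) \<partial>Pi\<^sub>M {..<n} (\<lambda>_. M))"
begin

abbreviation M_pow :: "nat \<Rightarrow> (nat \<Rightarrow> 'a) measure" where
  "M_pow n \<equiv> Pi\<^sub>M {..<n} (\<lambda>_. M)"

definition abs_moment :: "('a \<Rightarrow> complex) \<Rightarrow> nat \<Rightarrow> ennreal" where
  "abs_moment g n = (\<integral>\<^sup>+x. (\<Prod>j<n. ennreal (norm (g (x j)))) * ennreal (R n x) \<partial>M_pow n)"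

text \<open>For step functions \<open>nn_integral_prod\<close> identifies it as the expectation of
  the product of 1 + |g(x_k)|.\<close>

definition abs_expansion :: "('a \<Rightarrow> complex) \<Rightarrow> ennreal" where
  "abs_expansion g = (\<Sum>n. ennreal (1 / fact n) * abs_moment g n)"

definition moment :: "('a \<Rightarrow> complex) \<Rightarrow> nat \<Rightarrow> complex" where
  "moment g n = (LINT x|M_pow n. (\<Prod>j<n. g (x j)) * complex_of_real (R n x))"

lemma num_points_measurable: "A \<in> sets M \<Longrightarrow> (\<lambda>\<xi>. num_points \<xi> A) \<in> borel_measurable P"
  using field by (simp_all add: random_point_field_def sets_M)

lemma point_count_measurable:
  "A \<in> sets M \<Longrightarrow> (\<lambda>\<xi>. point_count \<xi> A) \<in> measurable P (count_space UNIV)"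
  using num_points_measurable[of A] unfolding point_count_def by measurable

lemma space_M: "space M = UNIV"
  using sets_eq_imp_space_eq[OF sets_M] by simp

lemma abs_moment_finite:
  assumes "abs_expansion g < \<infinity>"
  shows "abs_moment g n < \<infinity>"
proof -
  have "ennreal (1 / fact n) * abs_moment g n < \<infinity>"
    using suminf_ennreal_finite(1) assms unfolding abs_expansion_def by blast
  then show ?thesis by (auto simp: ennreal_mult_less_top)
qed

lemma summable_abs_moment:
  assumes "abs_expansion g < \<infinity>"
  shows "summable (\<lambda>n. enn2real (abs_moment g n) / fact n)"
proof -
  have "summable (\<lambda>n. enn2real (ennreal (1 / fact n) * abs_moment g n))"
    by (rule suminf_ennreal_finite(2)) (use assms in \<open>simp add: abs_expansion_def\<close>)
  then show ?thesis by (simp add: enn2real_mult)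
qed

lemma one_point_moment:
  assumes "A \<in> sets M"
  shows "(\<integral>\<^sup>+\<xi>. num_points \<xi> A \<partial>P) = (\<integral>\<^sup>+x. indicator A (x 0) * ennreal (R 1 x) \<partial>M_pow 1)"
  using correlation[of 1 "\<lambda>_. A" "\<lambda>_. 0" 1] assms
  by (simp add: letter_count_def disjoint_family_on_def)

lemma measurable_M_pow_component:
  "j < n \<Longrightarrow> (\<lambda>x. x j) \<in> measurable (M_pow n) M"
  by (rule measurable_component_singleton) simp

text \<open>On A the modulus of g is at least b, so b times the expected count of A is at most the
  first absolute moment of g, which is finite.\<close>

lemma num_points_AE_finite:
  assumes g: "\<And>x. x \<in> A \<Longrightarrow> b \<le> norm (g x)" "b > 0" and A: "A \<in> sets M" and fin: "abs_expansion g < \<infinity>"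
  shows "AE \<xi> in P. num_points \<xi> A < \<infinity>"
proof -
  have "abs_moment g 1 < \<infinity>" by (rule abs_moment_finite[OF fin])
  moreover have "ennreal b * (\<integral>\<^sup>+x. indicator A (x 0) * ennreal (R 1 x) \<partial>M_pow 1) \<le> abs_moment g 1"
  proof -
    have [measurable]: "A \<in> sets M" by fact
    have [measurable]: "(\<lambda>x. x 0) \<in> measurable (M_pow 1) M"
      by (rule measurable_M_pow_component) simp
    have "ennreal b * (\<integral>\<^sup>+x. indicator A (x 0) * ennreal (R 1 x) \<partial>M_pow 1) =
        (\<integral>\<^sup>+x. ennreal b * (indicator A (x 0) * ennreal (R 1 x)) \<partial>M_pow 1)"
      by (rule nn_integral_cmult[symmetric]) measurable
    also have "\<dots> \<le> abs_moment g 1"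
      unfolding abs_moment_def using g
      by (intro nn_integral_mono) (auto simp: indicator_def intro!: mult_right_mono ennreal_leI)
    finally show ?thesis .
  qed
  ultimately have "ennreal b * (\<integral>\<^sup>+x. indicator A (x 0) * ennreal (R 1 x) \<partial>M_pow 1) < \<infinity>"
    by (rule order.strict_trans1[rotated])
  then have "(\<integral>\<^sup>+\<xi>. num_points \<xi> A \<partial>P) \<noteq> \<infinity>"
    unfolding one_point_moment[OF A] using \<open>b > 0\<close> by (auto simp: ennreal_mult_less_top)
  then have "AE \<xi> in P. num_points \<xi> A \<noteq> \<infinity>"
    by (rule nn_integral_noteq_infinite[OF num_points_measurable[OF A]])
  then show ?thesis by (simp add: less_top)
qed

end

subsection \<open>Step functions\<close>

context symmetric_correlations
begin

definition falling_count :: "(nat \<Rightarrow> 'a set) \<Rightarrow> nat \<Rightarrow> nat \<Rightarrow> (nat \<Rightarrow> nat) \<Rightarrow> 'a config \<Rightarrow> real" where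
  "falling_count A m n w \<xi> = real (\<Prod>i<m. falling (point_count \<xi> (A i)) (letter_count n w i))"

definition block_density :: "(nat \<Rightarrow> 'a set) \<Rightarrow> nat \<Rightarrow> (nat \<Rightarrow> nat) \<Rightarrow> (nat \<Rightarrow> 'a) \<Rightarrow> real" where
  "block_density A n w x = (\<Prod>j<n. indicator (A (w j)) (x j)) * R n x"

lemma falling_count_measurable:
  assumes "\<And>i. i < m \<Longrightarrow> A i \<in> sets M"
  shows "falling_count A m n w \<in> borel_measurable P"
proof -
  have "(\<lambda>\<xi>. real (falling (point_count \<xi> (A i)) (letter_count n w i))) \<in> borel_measurable P" if "i < m" for i
    by (rule measurable_compose[OF point_count_measurable[OF assms[OF that]]]) simp
  then have "(\<lambda>\<xi>. \<Prod>i<m. real (falling (point_count \<xi> (A i)) (letter_count n w i))) \<in> borel_measurable P"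
    by (intro borel_measurable_prod) simp
  then show ?thesis by (simp add: falling_count_def[abs_def])
qed

lemma block_density_measurable:
  assumes "\<And>i. i < m \<Longrightarrow> A i \<in> sets M" "w \<in> {..<n} \<rightarrow> {..<m}"
  shows "block_density A n w \<in> borel_measurable (M_pow n)"
proof -
  have "(\<lambda>x. indicator (A (w j)) (x j) :: real) \<in> borel_measurable (M_pow n)" if "j < n" for j
  proof (rule measurable_compose[OF measurable_M_pow_component[OF that]])
    show "(indicator (A (w j)) :: 'a \<Rightarrow> real) \<in> borel_measurable M"
      using assms that by (intro borel_measurable_indicator) auto
  qed
  then show ?thesis
    unfolding block_density_def[abs_def] by (intro borel_measurable_times borel_measurable_prod R_measurable) simp
qed

lemma falling_count_nonneg: "0 \<le> falling_count A m n w \<xi>"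
  unfolding falling_count_def by (rule of_nat_0_le_iff)

lemma block_density_nonneg: "0 \<le> block_density A n w x"
  by (simp add: block_density_def prod_nonneg R_nonneg)

text \<open>Off the null set where some count is infinite, \<open>num_points\<close> and
  \<open>point_count\<close> agree, so the correlation identity passes to natural-number
  counts.\<close>

lemma nn_integral_falling_count:
  assumes A: "\<And>i. i < m \<Longrightarrow> A i \<in> sets M" "disjoint_family_on A {..<m}" "w \<in> {..<n} \<rightarrow> {..<m}"
    and fin: "\<And>i. i < m \<Longrightarrow> AE \<xi> in P. num_points \<xi> (A i) < \<infinity>"
  shows "(\<integral>\<^sup>+\<xi>. ennreal (falling_count A m n w \<xi>) \<partial>P) = (\<integral>\<^sup>+x. ennreal (block_density A n w x) \<partial>M_pow n)"
proof -
  have "AE \<xi> in P. \<forall>i\<in>{..<m}. num_points \<xi> (A i) < \<infinity>"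
    using fin by (intro AE_finite_allI) auto
  then have "AE \<xi> in P. ennreal (falling_count A m n w \<xi>) =
      (\<Prod>i<m. \<Prod>j<letter_count n w i. num_points \<xi> (A i) - of_nat j)"
  proof eventually_elim
    case (elim \<xi>)
    have "(\<Prod>i<m. \<Prod>j<letter_count n w i. num_points \<xi> (A i) - of_nat j) =
        (\<Prod>i<m. \<Prod>j<letter_count n w i. of_nat (point_count \<xi> (A i)) - of_nat j)"
    proof (rule prod.cong[OF refl], rule prod.cong[OF refl])
      fix i j assume "i \<in> {..<m}"
      with elim have "num_points \<xi> (A i) < \<infinity>" by (rule bspec)
      then show "num_points \<xi> (A i) - of_nat j = of_nat (point_count \<xi> (A i)) - of_nat j"
        using num_points_finite(3) by metis
    qed
    also have "\<dots> = (of_nat (\<Prod>i<m. falling (point_count \<xi> (A i)) (letter_count n w i)) :: ennreal)"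
      by (simp add: falling_ennreal)
    finally show ?case
      unfolding falling_count_def ennreal_of_nat_eq_real_of_nat[symmetric] by (rule sym)
  qed
  then have "(\<integral>\<^sup>+\<xi>. ennreal (falling_count A m n w \<xi>) \<partial>P) =
      (\<integral>\<^sup>+\<xi>. (\<Prod>i<m. \<Prod>j<letter_count n w i. num_points \<xi> (A i) - of_nat j) \<partial>P)"
    by (rule nn_integral_cong_AE)
  also have "\<dots> = (\<integral>\<^sup>+x. (\<Prod>j<n. indicator (A (w j)) (x j)) * ennreal (R n x) \<partial>M_pow n)"
    by (rule correlation[OF A])
  also have "\<dots> = (\<integral>\<^sup>+x. ennreal (block_density A n w x) \<partial>M_pow n)"
    by (simp add: block_density_def ennreal_mult prod_nonneg R_nonneg flip: ennreal_indicator prod_ennreal)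
  finally show ?thesis .
qed

end

text \<open>Step functions $g = \sum_i c_i 1_{A_i}$ with disjoint \<open>A i\<close>, for which
  $\prod_k (1 + g(x_k)) = \prod_i (1 + c_i)^{\#(A_i)}$ only involves the counts.\<close>

locale step_function = symmetric_correlations M P R
  for M :: "'a::topological_space measure" and P R +
  fixes m :: nat and A :: "nat \<Rightarrow> 'a set" and c :: "nat \<Rightarrow> complex" and g :: "'a \<Rightarrow> complex"
  assumes A: "\<And>i. i < m \<Longrightarrow> A i \<in> sets M" and disj: "disjoint_family_on A {..<m}"
    and c: "\<And>i. i < m \<Longrightarrow> c i \<noteq> 0"
    and g: "\<And>x. g x = (\<Sum>i<m. c i * indicator (A i) x)"
    and finite_expansion: "abs_expansion g < \<infinity>"
begin

lemma norm_g: "norm (g x) = (\<Sum>i<m. norm (c i) * indicator (A i) x)"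
proof (cases "\<exists>i<m. x \<in> A i")
  case True
  then obtain i where i: "i < m" "x \<in> A i" by auto
  show ?thesis
    unfolding g sum_indicator_disjoint[OF disj i] ..
next
  case False
  then have out: "\<forall>i<m. x \<notin> A i" by simp
  show ?thesis
    unfolding g sum_indicator_outside[OF out] by simp
qed

lemma counts_finite: "i < m \<Longrightarrow> AE \<xi> in P. num_points \<xi> (A i) < \<infinity>"
proof (rule num_points_AE_finite[of "A i" "norm (c i)" g])
  fix x assume "i < m" "x \<in> A i"
  then show "norm (c i) \<le> norm (g x)"
    unfolding g using sum_indicator_disjoint[OF disj, of i x c] by simp
qed (use finite_expansion in \<open>simp_all add: c A\<close>)

abbreviation words :: "nat \<Rightarrow> (nat \<Rightarrow> nat) set" where
  "words n \<equiv> {..<n} \<rightarrow>\<^sub>E {..<m}"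

lemma finite_words: "finite (words n)"
  by (rule finite_PiE) auto

lemma words_Pi: "w \<in> words n \<Longrightarrow> w \<in> {..<n} \<rightarrow> {..<m}"
  by auto

text \<open>Multiplying out the sums of \<open>norm_g\<close> gives one term per word, that is, per
  choice of a block for each coordinate.\<close>

lemma abs_moment_words:
  "abs_moment g n = (\<Sum>w\<in>words n. ennreal (\<Prod>j<n. norm (c (w j))) *
     (\<integral>\<^sup>+x. ennreal (block_density A n w x) \<partial>M_pow n))"
proof -
  have "(\<Prod>j<n. ennreal (norm (g (x j)))) * ennreal (R n x) =
      (\<Sum>w\<in>words n. ennreal (\<Prod>j<n. norm (c (w j))) * ennreal (block_density A n w x))" for x
  proof -
    have "(\<Prod>j<n. norm (g (x j))) * R n x =
        (\<Sum>w\<in>words n. \<Prod>j<n. norm (c (w j)) * indicator (A (w j)) (x j)) * R n x"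
      unfolding norm_g by (subst prod_sum_PiE) simp_all
    also have "\<dots> = (\<Sum>w\<in>words n. (\<Prod>j<n. norm (c (w j))) * block_density A n w x)"
      by (simp add: block_density_def prod.distrib sum_distrib_right mult.assoc)
    finally have "ennreal ((\<Prod>j<n. norm (g (x j))) * R n x) =
        ennreal (\<Sum>w\<in>words n. (\<Prod>j<n. norm (c (w j))) * block_density A n w x)" by simp
    then show ?thesis
      by (simp add: ennreal_mult prod_nonneg R_nonneg block_density_nonneg prod_ennreal
          flip: sum_ennreal)
  qed
  then have "abs_moment g n = (\<integral>\<^sup>+x. (\<Sum>w\<in>words n. ennreal (\<Prod>j<n. norm (c (w j))) *
      ennreal (block_density A n w x)) \<partial>M_pow n)"
    by (simp add: abs_moment_def)
  also have "\<dots> = (\<Sum>w\<in>words n. \<integral>\<^sup>+x. ennreal (\<Prod>j<n. norm (c (w j))) *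
      ennreal (block_density A n w x) \<partial>M_pow n)"
    using block_density_measurable[OF A words_Pi]
    by (intro nn_integral_sum borel_measurable_times_ennreal borel_measurable_const
        measurable_compose[OF _ measurable_ennreal]) simp_all
  also have "\<dots> = (\<Sum>w\<in>words n. ennreal (\<Prod>j<n. norm (c (w j))) *
      (\<integral>\<^sup>+x. ennreal (block_density A n w x) \<partial>M_pow n))"
    using block_density_measurable[OF A words_Pi]
    by (intro sum.cong nn_integral_cmult measurable_compose[OF _ measurable_ennreal]) simp_all
  finally show ?thesis .
qed

text \<open>Each word is one nonnegative summand of the finite \<open>abs_moment g n\<close>. Its
  coefficient is positive because no \<open>c i\<close> vanishes, so it can be divided out.\<close>

lemma block_density_integral:
  assumes w: "w \<in> words n"
  shows "integrable (M_pow n) (block_density A n w)" "integrable P (falling_count A m n w)"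
    and "integral\<^sup>L P (falling_count A m n w) = integral\<^sup>L (M_pow n) (block_density A n w)"
proof -
  define C where "C = (\<Prod>j<n. norm (c (w j)))"
  have "c (w j) \<noteq> 0" if "j < n" for j
    using c[of "w j"] w that by auto
  then have C: "C > 0"
    unfolding C_def by (intro prod_pos) simp
  have "ennreal C * (\<integral>\<^sup>+x. ennreal (block_density A n w x) \<partial>M_pow n) \<le> abs_moment g n"
    unfolding abs_moment_words C_def by (rule member_le_sum[OF w]) (simp_all add: finite_words)
  also have "\<dots> < \<infinity>" by (rule abs_moment_finite[OF finite_expansion])
  finally have fin: "(\<integral>\<^sup>+x. ennreal (block_density A n w x) \<partial>M_pow n) < \<infinity>"
    using C by (auto simp: ennreal_mult_less_top)
  have eq: "(\<integral>\<^sup>+\<xi>. ennreal (falling_count A m n w \<xi>) \<partial>P) = (\<integral>\<^sup>+x. ennreal (block_density A n w x) \<partial>M_pow n)"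
    by (rule nn_integral_falling_count[OF A disj words_Pi[OF w] counts_finite])
  have meas: "block_density A n w \<in> borel_measurable (M_pow n)" "falling_count A m n w \<in> borel_measurable P"
    by (rule block_density_measurable[OF A words_Pi[OF w]] falling_count_measurable[OF A], assumption)+
  have nn: "AE \<xi> in P. 0 \<le> falling_count A m n w \<xi>" "AE x in M_pow n. 0 \<le> block_density A n w x"
    by (simp_all add: falling_count_nonneg block_density_nonneg)
  show "integrable (M_pow n) (block_density A n w)"
    by (rule integrableI_nonneg[OF meas(1) nn(2) fin])
  show "integrable P (falling_count A m n w)"
    by (rule integrableI_nonneg[OF meas(2) nn(1)]) (simp only: eq fin)
  show "integral\<^sup>L P (falling_count A m n w) = integral\<^sup>L (M_pow n) (block_density A n w)"
    unfolding integral_eq_nn_integral[OF meas(1) nn(2)] integral_eq_nn_integral[OF meas(2) nn(1)] eq ..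
qed

definition expansion_term :: "nat \<Rightarrow> 'a config \<Rightarrow> complex" where
  "expansion_term n \<xi> = falling_word_sum c m n (\<lambda>i. point_count \<xi> (A i))"

definition abs_term :: "nat \<Rightarrow> 'a config \<Rightarrow> real" where
  "abs_term n \<xi> = falling_word_sum (\<lambda>i. norm (c i)) m n (\<lambda>i. point_count \<xi> (A i))"

lemma term_altdef:
  "expansion_term n \<xi> = (\<Sum>w\<in>words n. (\<Prod>j<n. c (w j)) * complex_of_real (falling_count A m n w \<xi>))"
  "abs_term n \<xi> = (\<Sum>w\<in>words n. (\<Prod>j<n. norm (c (w j))) * falling_count A m n w \<xi>)"
  by (simp_all add: expansion_term_def abs_term_def falling_word_sum_def falling_count_def)

lemma norm_term_le: "norm (expansion_term n \<xi>) \<le> abs_term n \<xi>"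
  unfolding term_altdef
  by (rule order.trans[OF norm_sum]) (simp add: norm_mult prod_norm[symmetric] falling_count_nonneg)

lemma abs_term_nonneg: "0 \<le> abs_term n \<xi>"
  using norm_term_le[of n \<xi>] norm_ge_zero order.trans by blast

lemma term_measurable: "expansion_term n \<in> borel_measurable P" "abs_term n \<in> borel_measurable P"
  unfolding term_altdef[abs_def]
  by (intro borel_measurable_sum borel_measurable_times borel_measurable_const
      measurable_compose[OF falling_count_measurable[OF A] borel_measurable_of_real]
      falling_count_measurable[OF A]; simp)+

lemma nn_integral_abs_term: "(\<integral>\<^sup>+\<xi>. ennreal (abs_term n \<xi>) \<partial>P) = abs_moment g n"
proof -
  have "(\<integral>\<^sup>+\<xi>. ennreal (abs_term n \<xi>) \<partial>P) =
      (\<integral>\<^sup>+\<xi>. (\<Sum>w\<in>words n. ennreal (\<Prod>j<n. norm (c (w j))) * ennreal (falling_count A m n w \<xi>)) \<partial>P)"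
    unfolding term_altdef
    by (simp add: falling_count_nonneg prod_nonneg ennreal_mult flip: sum_ennreal)
  also have "\<dots> = (\<Sum>w\<in>words n. \<integral>\<^sup>+\<xi>. ennreal (\<Prod>j<n. norm (c (w j))) * ennreal (falling_count A m n w \<xi>) \<partial>P)"
    by (intro nn_integral_sum borel_measurable_times_ennreal borel_measurable_const
        measurable_compose[OF falling_count_measurable[OF A] measurable_ennreal]) simp_all
  also have "\<dots> = (\<Sum>w\<in>words n. ennreal (\<Prod>j<n. norm (c (w j))) * (\<integral>\<^sup>+\<xi>. ennreal (falling_count A m n w \<xi>) \<partial>P))"
    by (intro sum.cong refl nn_integral_cmult
        measurable_compose[OF falling_count_measurable[OF A] measurable_ennreal]) simp_all
  also have "\<dots> = abs_moment g n"
    unfolding abs_moment_words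
    by (intro sum.cong refl) (simp add: nn_integral_falling_count[OF A disj words_Pi counts_finite])
  finally show ?thesis .
qed

lemma integrable_term: "integrable P (expansion_term n)"
  unfolding term_altdef[abs_def] using block_density_integral(2) by (intro Bochner_Integration.integrable_sum integrable_mult_right integrable_of_real) simp

lemma integral_term: "integral\<^sup>L P (expansion_term n) = moment g n"
proof -
  have prod_eq: "(\<Prod>j<n. g (x j)) * complex_of_real (R n x) =
      (\<Sum>w\<in>words n. (\<Prod>j<n. c (w j)) * complex_of_real (block_density A n w x))" for x
  proof -
    have ind: "complex_of_real (indicator B y) = indicator B y" for B :: "'a set" and y
      by (simp add: indicator_def)
    have "(\<Prod>j<n. g (x j)) = (\<Sum>w\<in>words n. \<Prod>j<n. c (w j) * indicator (A (w j)) (x j))"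
      unfolding g by (subst prod_sum_PiE) simp_all
    then show ?thesis
      by (simp add: block_density_def prod.distrib sum_distrib_right mult.assoc ind)
  qed
  have "integral\<^sup>L P (expansion_term n) = (\<Sum>w\<in>words n. (\<Prod>j<n. c (w j)) * complex_of_real (integral\<^sup>L P (falling_count A m n w)))"
    unfolding term_altdef[abs_def] using block_density_integral(2)
    by (subst Bochner_Integration.integral_sum) (simp_all add: integrable_of_real)
  also have "\<dots> = (\<Sum>w\<in>words n. (\<Prod>j<n. c (w j)) * complex_of_real (integral\<^sup>L (M_pow n) (block_density A n w)))"
    by (simp add: block_density_integral(3))
  also have "\<dots> = moment g n"
    unfolding moment_def prod_eq using block_density_integral(1)
    by (subst Bochner_Integration.integral_sum) (simp_all add: integrable_of_real)
  finally show ?thesis .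
qed

lemma term_sums:
  "(\<lambda>n. expansion_term n \<xi> / fact n) sums (\<Prod>i<m. (1 + c i) ^ point_count \<xi> (A i))"
  "(\<lambda>n. abs_term n \<xi> / fact n) sums (\<Prod>i<m. (1 + norm (c i)) ^ point_count \<xi> (A i))"
  unfolding expansion_term_def abs_term_def by (rule falling_word_sum_sums)+

text \<open>With weights |c_i| all terms of the expansion are nonnegative, so sum and expectation
  may be exchanged without a bound.\<close>

lemma nn_integral_prod:
  "(\<integral>\<^sup>+\<xi>. ennreal (\<Prod>i<m. (1 + norm (c i)) ^ point_count \<xi> (A i)) \<partial>P) = abs_expansion g"
proof -
  have "ennreal (\<Prod>i<m. (1 + norm (c i)) ^ point_count \<xi> (A i)) = (\<Sum>n. ennreal (1 / fact n) * ennreal (abs_term n \<xi>))" for \<xi>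
  proof -
    have "(\<lambda>n. ennreal (abs_term n \<xi> / fact n)) sums ennreal (\<Prod>i<m. (1 + norm (c i)) ^ point_count \<xi> (A i))"
      using term_sums(2)[of \<xi>] by (subst sums_ennreal) (auto simp: abs_term_nonneg intro!: prod_nonneg)
    moreover have "ennreal (abs_term n \<xi> / fact n) = ennreal (1 / fact n) * ennreal (abs_term n \<xi>)" for n
      by (simp add: ennreal_mult[symmetric] abs_term_nonneg)
    ultimately show ?thesis by (simp add: sums_unique)
  qed
  moreover have "(\<integral>\<^sup>+\<xi>. (\<Sum>n. ennreal (1 / fact n) * ennreal (abs_term n \<xi>)) \<partial>P) = abs_expansion g"
    using term_measurable(2) unfolding abs_expansion_def
    by (subst nn_integral_suminf) (simp_all add: nn_integral_cmult nn_integral_abs_term)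
  ultimately show ?thesis by simp
qed

text \<open>For complex weights the exchange needs a majorant: \<open>abs_term\<close> dominates the
  terms pointwise, and its expectations \<open>abs_moment g n\<close>, divided by n!, are
  summable.\<close>

lemma integral_prod:
  "(LINT \<xi>|P. (\<Prod>i<m. (1 + c i) ^ point_count \<xi> (A i))) = (\<Sum>n. moment g n / fact n)"
proof -
  have "(LINT \<xi>|P. (\<Prod>i<m. (1 + c i) ^ point_count \<xi> (A i))) = (LINT \<xi>|P. (\<Sum>n. expansion_term n \<xi> / fact n))"
    using term_sums(1) by (simp add: sums_iff)
  also have "\<dots> = (\<Sum>n. LINT \<xi>|P. expansion_term n \<xi> / fact n)"
  proof (rule integral_suminf)
    show "integrable P (\<lambda>\<xi>. expansion_term n \<xi> / fact n)" for n
      using integrable_term by simp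
    have le: "norm (expansion_term n \<xi> / fact n) \<le> abs_term n \<xi> / fact n" for n \<xi>
      using norm_term_le[of n \<xi>] by (simp add: norm_divide divide_right_mono)
    show "AE \<xi> in P. summable (\<lambda>n. norm (expansion_term n \<xi> / fact n))"
    proof (rule AE_I2)
      fix \<xi> show "summable (\<lambda>n. norm (expansion_term n \<xi> / fact n))"
        by (rule summable_comparison_test'[OF sums_summable[OF term_sums(2)[of \<xi>]], of 0]) (use le in simp)
    qed
    have sm: "summable (\<lambda>n. enn2real (abs_moment g n) / fact n)"
      by (rule summable_abs_moment[OF finite_expansion])
    show "summable (\<lambda>n. LINT \<xi>|P. norm (expansion_term n \<xi> / fact n))"
    proof (rule summable_comparison_test'[OF sm, of 0])
      fix n
      have i: "integrable P (abs_term n)"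
        by (rule integrableI_nonneg[OF term_measurable(2)])
          (simp_all add: abs_term_nonneg nn_integral_abs_term abs_moment_finite[OF finite_expansion, simplified])
      have "(LINT \<xi>|P. norm (expansion_term n \<xi> / fact n)) \<le> (LINT \<xi>|P. abs_term n \<xi> / fact n)"
        using i integrable_term[of n] le by (intro integral_mono) simp_all
      also have "\<dots> = enn2real (abs_moment g n) / fact n"
        by (simp add: integral_eq_nn_integral[OF term_measurable(2)] abs_term_nonneg nn_integral_abs_term)
      finally show "norm (LINT \<xi>|P. norm (expansion_term n \<xi> / fact n)) \<le> enn2real (abs_moment g n) / fact n"
        by simp
    qed
  qed
  also have "\<dots> = (\<Sum>n. moment g n / fact n)"
    by (simp add: integral_term)
  finally show ?thesis .
qed

lemma point_products:
  fixes \<phi> :: "complex \<Rightarrow> 'b::comm_monoid_mult"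
  shows "AE \<xi> in P. finite {x. \<xi> x > 0 \<and> g x \<noteq> 0} \<and>
    (\<Prod>x | \<xi> x > 0 \<and> g x \<noteq> 0. \<phi> (g x) ^ \<xi> x) = (\<Prod>i<m. \<phi> (c i) ^ point_count \<xi> (A i))"
proof -
  have "AE \<xi> in P. \<forall>i\<in>{..<m}. num_points \<xi> (A i) < \<infinity>"
    using counts_finite by (intro AE_finite_allI) auto
  then show ?thesis
  proof eventually_elim
    case (elim \<xi>)
    then have "num_points \<xi> (A i) < \<infinity>" if "i < m" for i using that by simp
    then show ?case by (intro conjI prod_step_function[OF disj c _ g])
  qed
qed

lemma product_measurable:
  fixes \<phi> :: "complex \<Rightarrow> 'b::{real_normed_field, second_countable_topology}"
  shows "(\<lambda>\<xi>. \<Prod>i<m. \<phi> (c i) ^ point_count \<xi> (A i)) \<in> borel_measurable P"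
proof (rule borel_measurable_prod)
  fix i assume "i \<in> {..<m}"
  then show "(\<lambda>\<xi>. \<phi> (c i) ^ point_count \<xi> (A i)) \<in> borel_measurable P"
    by (intro measurable_compose[OF point_count_measurable[OF A], of i]) simp_all
qed

end

section \<open>Expectation of products for simple functions\<close>

context symmetric_correlations
begin

text \<open>The blocks are the level sets of the nonzero values of g. Products over points agree
  with functions of the counts only almost surely, so measurable versions Q and D are handed on in
  their place.\<close>

lemma simple_function_expectation:
  assumes g: "simple_function M g" and fin: "abs_expansion g < \<infinity>"
  obtains Q D where "Q \<in> borel_measurable P" "D \<in> borel_measurable P"
    "AE \<xi> in P. finite {x. \<xi> x > 0 \<and> g x \<noteq> 0} \<and>
       Q \<xi> = (\<Prod>x | \<xi> x > 0 \<and> g x \<noteq> 0. (1 + g x) ^ \<xi> x) \<and>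
       D \<xi> = (\<Prod>x | \<xi> x > 0 \<and> g x \<noteq> 0. (1 + norm (g x)) ^ \<xi> x)"
    "integral\<^sup>L P Q = (\<Sum>n. moment g n / fact n)"
    "(\<integral>\<^sup>+\<xi>. ennreal (D \<xi>) \<partial>P) = abs_expansion g"
proof -
  have "finite (range g - {0})" using g space_M by (simp add: simple_function_def)
  then obtain c m where c: "c ` {..<m::nat} = range g - {0}" "inj_on c {..<m}"
    using finite_imp_nat_seg_image_inj_on[of "range g - {0}"] by (auto simp: lessThan_def)
  define A where "A i = g -` {c i}" for i
  have A: "A i \<in> sets M" if "i < m" for i
  proof -
    have "c i \<in> range g" using c(1) that by auto
    then obtain x where "c i = g x" by auto
    then show ?thesis using g space_M by (simp add: simple_function_def A_def)
  qed
  have disj: "disjoint_family_on A {..<m}"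
    using c(2) by (auto simp: disjoint_family_on_def A_def inj_on_def)
  have c0: "c i \<noteq> 0" if "i < m" for i using c(1) that by auto
  have step: "g x = (\<Sum>i<m. c i * indicator (A i) x)" for x
  proof (cases "g x = 0")
    case True
    then have "\<forall>i<m. x \<notin> A i" using c0 by (auto simp: A_def)
    then show ?thesis using True sum_indicator_outside[of m x A c] by simp
  next
    case False
    then have "g x \<in> c ` {..<m}" using c(1) by simp
    then obtain i where i: "i < m" "x \<in> A i" by (auto simp: A_def)
    then show ?thesis using sum_indicator_disjoint[OF disj i, of c] by (simp add: A_def)
  qed
  interpret step_function M P R m A c g
    by unfold_locales (fact A disj c0 step fin)+
  show ?thesis
  proof (rule that)
    show "(\<lambda>\<xi>. \<Prod>i<m. (1 + c i) ^ point_count \<xi> (A i)) \<in> borel_measurable P"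
      by (rule product_measurable)
    show "(\<lambda>\<xi>. \<Prod>i<m. (1 + norm (c i)) ^ point_count \<xi> (A i)) \<in> borel_measurable P"
      by (rule product_measurable)
    show "AE \<xi> in P. finite {x. \<xi> x > 0 \<and> g x \<noteq> 0} \<and>
       (\<Prod>i<m. (1 + c i) ^ point_count \<xi> (A i)) = (\<Prod>x | \<xi> x > 0 \<and> g x \<noteq> 0. (1 + g x) ^ \<xi> x) \<and>
       (\<Prod>i<m. (1 + norm (c i)) ^ point_count \<xi> (A i)) = (\<Prod>x | \<xi> x > 0 \<and> g x \<noteq> 0. (1 + norm (g x)) ^ \<xi> x)"
      using point_products[of "\<lambda>z. 1 + z"] point_products[of "\<lambda>z. 1 + norm z"]
      by eventually_elim simp
  qed (rule integral_prod, rule nn_integral_prod)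
qed

end

subsection \<open>Products over configurations\<close>

text \<open>Multiplying out u = 1 + (u - 1), every nonconstant monomial in the u - 1 is bounded by
  the one in the v - 1. The induction step is u w - 1 = (u - 1)(w - 1) + (u - 1) + (w - 1).\<close>

lemma norm_prod_minus1_le:
  fixes u :: "'a \<Rightarrow> complex"
  assumes "\<And>x. x \<in> F \<Longrightarrow> norm (u x - 1) \<le> v x - 1"
  shows "norm ((\<Prod>x\<in>F. u x) - 1) \<le> (\<Prod>x\<in>F. v x) - 1"
  using assms
proof (induction F rule: infinite_finite_induct)
  case (insert y F)
  define U V where "U = prod u F" and "V = prod v F"
  have IH: "norm (U - 1) \<le> V - 1" unfolding U_def V_def using insert.prems by (intro insert.IH) simp
  have y: "norm (u y - 1) \<le> v y - 1" using insert.prems by simp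
  have "u y * U - 1 = (u y - 1) * (U - 1) + (u y - 1) + (U - 1)" by (simp add: algebra_simps)
  also have "norm \<dots> \<le> norm (u y - 1) * norm (U - 1) + norm (u y - 1) + norm (U - 1)"
    by (metis add_mono_thms_linordered_semiring(3) norm_mult norm_triangle_ineq norm_triangle_mono order_refl)
  also have "\<dots> \<le> (v y - 1) * (V - 1) + (v y - 1) + (V - 1)"
    by (intro add_mono mult_mono y IH order.trans[OF norm_ge_zero y]) simp_all
  also have "\<dots> = v y * V - 1" by (simp add: algebra_simps)
  finally show ?case using insert.hyps by (simp add: U_def V_def)
qed simp_all

lemma norm_prod_power_minus1_le:
  fixes h :: "'a \<Rightarrow> complex"
  shows "norm ((\<Prod>x\<in>F. (1 + h x) ^ k x) - 1) \<le> (\<Prod>x\<in>F. (1 + norm (h x)) ^ k x) - 1"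
proof (rule norm_prod_minus1_le)
  fix x show "norm ((1 + h x) ^ k x - 1) \<le> (1 + norm (h x)) ^ k x - 1"
    using norm_prod_minus1_le[of "{..<k x}" "\<lambda>_. 1 + h x" "\<lambda>_. 1 + norm (h x)"] by simp
qed

lemma norm_prod_power_le:
  fixes h :: "'a \<Rightarrow> complex"
  shows "norm (\<Prod>x\<in>F. (1 + h x) ^ k x) \<le> (\<Prod>x\<in>F. (1 + norm (h x)) ^ k x)"
proof -
  have "norm (1 + h x) \<le> 1 + norm (h x)" for x
    using norm_triangle_ineq[of 1 "h x"] by simp
  then show ?thesis
    by (auto simp: norm_power simp flip: prod_norm intro!: prod_mono power_mono)
qed

text \<open>Enlarging F to F' multiplies by the product over F' - F, so the increment is a product
  times another product minus 1, and both factors are bounded by those for |g|. The bound does not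
  involve h, so it controls all functions dominated by g at once.\<close>

lemma norm_prod_power_diff_le:
  fixes g h :: "'a \<Rightarrow> complex"
  assumes "finite F'" "F \<subseteq> F'" and le: "\<And>x. norm (h x) \<le> norm (g x)"
  shows "norm ((\<Prod>x\<in>F'. (1 + h x) ^ k x) - (\<Prod>x\<in>F. (1 + h x) ^ k x)) \<le>
    (\<Prod>x\<in>F'. (1 + norm (g x)) ^ k x) - (\<Prod>x\<in>F. (1 + norm (g x)) ^ k x)"
proof -
  have split: "(\<Prod>x\<in>F'. u x) = (\<Prod>x\<in>F. u x) * (\<Prod>x\<in>F' - F. u x)" for u :: "'a \<Rightarrow> 'b::comm_monoid_mult"
    using prod.subset_diff[OF assms(2,1), of u] by (simp add: mult.commute)
  have mono: "(\<Prod>x\<in>S. (1 + norm (h x)) ^ k x) \<le> (\<Prod>x\<in>S. (1 + norm (g x)) ^ k x)" for S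
    by (intro prod_mono conjI power_mono zero_le_power) (auto simp: le)
  have ge1: "1 \<le> (\<Prod>x\<in>S. (1 + norm (h x)) ^ k x)" for S
    by (intro prod_ge_1 one_le_power) simp
  have "(\<Prod>x\<in>F'. (1 + h x) ^ k x) - (\<Prod>x\<in>F. (1 + h x) ^ k x) =
      (\<Prod>x\<in>F. (1 + h x) ^ k x) * ((\<Prod>x\<in>F' - F. (1 + h x) ^ k x) - 1)"
    unfolding split[of "\<lambda>x. (1 + h x) ^ k x"] by (simp add: algebra_simps)
  also have "norm \<dots> \<le> (\<Prod>x\<in>F. (1 + norm (h x)) ^ k x) * ((\<Prod>x\<in>F' - F. (1 + norm (h x)) ^ k x) - 1)"
    unfolding norm_mult
    by (intro mult_mono norm_prod_power_le norm_prod_power_minus1_le) (auto intro: prod_nonneg)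
  also have "\<dots> \<le> (\<Prod>x\<in>F. (1 + norm (g x)) ^ k x) * ((\<Prod>x\<in>F' - F. (1 + norm (g x)) ^ k x) - 1)"
    using mono ge1[of "F' - F"] by (intro mult_mono diff_right_mono) (auto intro: prod_nonneg)
  also have "\<dots> = (\<Prod>x\<in>F'. (1 + norm (g x)) ^ k x) - (\<Prod>x\<in>F. (1 + norm (g x)) ^ k x)"
    unfolding split[of "\<lambda>x. (1 + norm (g x)) ^ k x"] by (simp add: algebra_simps)
  finally show ?thesis .
qed

text \<open>A finite D bounds the products of 1 + |g| over all finite sets of points. Beyond a
  suitable finite set F, further factors then change the products for g and for every
  \<open>f j\<close> by at most e/3, while on F itself the factors converge one by one.\<close>

lemma config_prod_dominated_convergence:
  fixes \<xi> :: "'a config" and f :: "nat \<Rightarrow> 'a \<Rightarrow> complex"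
  assumes lim: "\<And>x. (\<lambda>j. f j x) \<longlonglongrightarrow> g x" and le: "\<And>j x. norm (f j x) \<le> norm (g x)"
    and fin: "\<And>j. finite {x. \<xi> x > 0 \<and> f j x \<noteq> 0}"
    and D: "D = liminf (\<lambda>j. ennreal (\<Prod>x | \<xi> x > 0 \<and> f j x \<noteq> 0. (1 + norm (f j x)) ^ \<xi> x))" "D < \<infinity>"
    and p: "has_config_prod (\<lambda>x. 1 + g x) \<xi> p"
  shows "(\<lambda>j. \<Prod>x | \<xi> x > 0 \<and> f j x \<noteq> 0. (1 + f j x) ^ \<xi> x) \<longlonglongrightarrow> p"
    and "norm (\<Prod>x | \<xi> x > 0 \<and> f j x \<noteq> 0. (1 + f j x) ^ \<xi> x) \<le> enn2real D"
proof -
  define S where "S = {x. \<xi> x > 0}"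
  define S' where "S' j = {x. \<xi> x > 0 \<and> f j x \<noteq> 0}" for j
  define B where "B F = (\<Prod>x\<in>F. (1 + norm (g x)) ^ \<xi> x)" for F
  \<comment> \<open>For fixed F the product for \<open>f j\<close> is at most the one over its whole
    support, since factors off the support are 1 and all are at least 1. Then the liminf in j is
    taken.\<close>
  have bound: "B F \<le> enn2real D" if F: "finite F" "F \<subseteq> S" for F
  proof -
    have "(\<Prod>x\<in>F. (1 + norm (f j x)) ^ \<xi> x) \<le> (\<Prod>x\<in>S' j. (1 + norm (f j x)) ^ \<xi> x)" for j
    proof -
      have "(\<Prod>x\<in>F. (1 + norm (f j x)) ^ \<xi> x) = (\<Prod>x\<in>F \<inter> S' j. (1 + norm (f j x)) ^ \<xi> x)"
        using F by (intro prod.mono_neutral_right) (auto simp: S_def S'_def)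
      also have "\<dots> \<le> (\<Prod>x\<in>S' j. (1 + norm (f j x)) ^ \<xi> x)"
        using fin[of j] by (intro prod_mono2) (auto simp: S'_def intro: one_le_power)
      finally show ?thesis .
    qed
    then have "liminf (\<lambda>j. ennreal (\<Prod>x\<in>F. (1 + norm (f j x)) ^ \<xi> x)) \<le> D"
      unfolding D(1) S'_def[symmetric] by (intro Liminf_mono always_eventually allI ennreal_leI)
    moreover have lim_B: "(\<lambda>j. ennreal (\<Prod>x\<in>F. (1 + norm (f j x)) ^ \<xi> x)) \<longlonglongrightarrow> ennreal (B F)"
      unfolding B_def by (intro tendsto_ennrealI tendsto_prod tendsto_power tendsto_add tendsto_const tendsto_norm lim)
    ultimately have "ennreal (B F) \<le> D"
      unfolding lim_imp_Liminf[OF trivial_limit_sequentially lim_B] by simp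
    then have "enn2real (ennreal (B F)) \<le> enn2real D"
      using D(2) by (intro enn2real_mono) simp_all
    then show ?thesis by (simp add: B_def prod_nonneg)
  qed
  have finS': "finite (S' j)" and S'S: "S' j \<subseteq> S" for j
    using fin[of j] by (auto simp: S'_def S_def)
  have "norm (\<Prod>x\<in>S' j. (1 + f j x) ^ \<xi> x) \<le> (\<Prod>x\<in>S' j. (1 + norm (f j x)) ^ \<xi> x)" for j
    by (rule norm_prod_power_le)
  also have "(\<Prod>x\<in>S' j. (1 + norm (f j x)) ^ \<xi> x) \<le> B (S' j)" for j
    unfolding B_def by (intro prod_mono conjI power_mono zero_le_power) (auto simp: le)
  finally show "norm (\<Prod>x | \<xi> x > 0 \<and> f j x \<noteq> 0. (1 + f j x) ^ \<xi> x) \<le> enn2real D"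
    using bound[OF finS' S'S, of j] unfolding S'_def[symmetric] by (rule order.trans)
  define s where "s = Sup (B ` {F. finite F \<and> F \<subseteq> S})"
  have bdd: "bdd_above (B ` {F. finite F \<and> F \<subseteq> S})"
    using bound by (intro bdd_aboveI) auto
  have B_le: "B F \<le> s" if "finite F" "F \<subseteq> S" for F
    unfolding s_def using that by (intro cSUP_upper bdd) simp
  have "(\<lambda>j. \<Prod>x\<in>S' j. (1 + f j x) ^ \<xi> x) \<longlonglongrightarrow> p"
  proof (rule LIMSEQ_I)
    fix e :: real assume "e > 0"
    have ne: "B ` {F. finite F \<and> F \<subseteq> S} \<noteq> {}" by auto
    \<comment> \<open>F is chosen with \<open>B F\<close> within e/3 of the supremum s, so that B
      grows by less than e/3 beyond F.\<close>
    have lt: "s - e / 3 < Sup (B ` {F. finite F \<and> F \<subseteq> S})"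
      using \<open>e > 0\<close> by (simp add: s_def)
    obtain b where "b \<in> B ` {F. finite F \<and> F \<subseteq> S}" "s - e / 3 < b"
      by (rule less_cSupE[OF lt ne])
    then obtain F where F: "finite F" "F \<subseteq> S" "s - e / 3 < B F"
      by auto
    have close: "norm ((\<Prod>x\<in>F'. (1 + h x) ^ \<xi> x) - (\<Prod>x\<in>F. (1 + h x) ^ \<xi> x)) \<le> e / 3"
      if "finite F'" "F' \<subseteq> S" "F \<subseteq> F'" "\<And>x. norm (h x) \<le> norm (g x)" for F' and h :: "'a \<Rightarrow> complex"
      using norm_prod_power_diff_le[OF that(1,3), of h g \<xi>] that(4) B_le[OF that(1,2)] F(3)
      by (simp add: B_def)
    have "\<forall>\<^sub>F F' in finite_subsets_at_top S. norm ((\<Prod>x\<in>F'. (1 + g x) ^ \<xi> x) - (\<Prod>x\<in>F. (1 + g x) ^ \<xi> x)) \<le> e / 3"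
      using F(1,2) close[of _ g] unfolding eventually_finite_subsets_at_top by auto
    moreover have "((\<lambda>F'. norm ((\<Prod>x\<in>F'. (1 + g x) ^ \<xi> x) - (\<Prod>x\<in>F. (1 + g x) ^ \<xi> x))) \<longlongrightarrow>
        norm (p - (\<Prod>x\<in>F. (1 + g x) ^ \<xi> x))) (finite_subsets_at_top S)"
      using p unfolding has_config_prod_def S_def by (intro tendsto_norm tendsto_diff tendsto_const)
    ultimately have p_close: "norm (p - (\<Prod>x\<in>F. (1 + g x) ^ \<xi> x)) \<le> e / 3"
      by (intro tendsto_upperbound[of _ _ "finite_subsets_at_top S"]) simp_all
    have f_close: "norm ((\<Prod>x\<in>S' j. (1 + f j x) ^ \<xi> x) - (\<Prod>x\<in>F. (1 + f j x) ^ \<xi> x)) \<le> e / 3" for j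
    proof -
      \<comment> \<open>F need not lie in the support of \<open>f j\<close>; adjoining it
        contributes only factors 1 and makes \<open>close\<close> applicable.\<close>
      have "(\<Prod>x\<in>S' j. (1 + f j x) ^ \<xi> x) = (\<Prod>x\<in>S' j \<union> F. (1 + f j x) ^ \<xi> x)"
        using F finS' by (intro prod.mono_neutral_left) (auto simp: S'_def S_def)
      then show ?thesis
        using close[of "S' j \<union> F" "f j"] F finS' S'S le by simp
    qed
    have lim_F: "(\<lambda>j. \<Prod>x\<in>F. (1 + f j x) ^ \<xi> x) \<longlonglongrightarrow> (\<Prod>x\<in>F. (1 + g x) ^ \<xi> x)"
      by (intro tendsto_prod tendsto_power tendsto_add tendsto_const lim)
    obtain J where J: "\<And>j. j \<ge> J \<Longrightarrow> norm ((\<Prod>x\<in>F. (1 + f j x) ^ \<xi> x) - (\<Prod>x\<in>F. (1 + g x) ^ \<xi> x)) < e / 3"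
      using LIMSEQ_D[OF lim_F, of "e / 3"] \<open>e > 0\<close> by auto
    have "norm ((\<Prod>x\<in>S' j. (1 + f j x) ^ \<xi> x) - p) < e" if "j \<ge> J" for j
    proof -
      have triangle: "norm (a - d) < e" if "norm (a - b) \<le> e / 3" "norm (b - c) < e / 3" "norm (d - c) \<le> e / 3" for a b c d :: complex
        using that norm_triangle_ineq[of "a - b" "b - c"] norm_triangle_ineq4[of "a - c" "d - c"] by simp
      show ?thesis by (rule triangle[OF f_close J[OF that] p_close])
    qed
    then show "\<exists>J. \<forall>j\<ge>J. norm ((\<Prod>x\<in>S' j. (1 + f j x) ^ \<xi> x) - p) < e" by blast
  qed
  then show "(\<lambda>j. \<Prod>x | \<xi> x > 0 \<and> f j x \<noteq> 0. (1 + f j x) ^ \<xi> x) \<longlonglongrightarrow> p"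
    by (simp add: S'_def)
qed

subsection \<open>Measurable functions\<close>

text \<open>Simple functions converging to g may exceed |g|. Their moduli are therefore cut down to
  simple functions increasing to |g|, while the directions are kept.\<close>

lemma simple_function_approximation_dominated:
  fixes g :: "'a \<Rightarrow> complex"
  assumes g: "g \<in> borel_measurable M" and space: "space M = UNIV"
  obtains f where "\<And>j. simple_function M (f j)" "\<And>x. (\<lambda>j. f j x) \<longlonglongrightarrow> g x"
    "\<And>j x. norm (f j x) \<le> norm (g x)"
proof -
  obtain F where F: "\<And>j. simple_function M (F j)" "\<And>x. (\<lambda>j. F j x) \<longlonglongrightarrow> g x"
    using borel_measurable_implies_sequence_metric[OF g, of 0] space by auto
  have "(\<lambda>x. norm (g x)) \<in> borel_measurable M" using g by simp
  then obtain U where U: "incseq U" "\<And>j. simple_function M (U j)" "\<And>x. bdd_above (range (\<lambda>j. U j x))"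
      "\<And>j x. 0 \<le> U j x" "(\<lambda>x. norm (g x)) = (SUP j. U j)"
    using borel_measurable_implies_simple_function_sequence_real[of "\<lambda>x. norm (g x)" M] by auto
  have sup: "norm (g x) = (SUP j. U j x)" for x
    using fun_cong[OF U(5), of x] by (simp add: image_comp)
  have U_le: "U j x \<le> norm (g x)" for j x
    unfolding sup using U(3) by (intro cSUP_upper) simp_all
  have U_lim: "(\<lambda>j. U j x) \<longlonglongrightarrow> norm (g x)" for x
    unfolding sup using U(1,3) by (intro LIMSEQ_incseq_SUP) (auto simp: incseq_def le_fun_def)
  \<comment> \<open>The modulus becomes the minimum of |F j x| and U j x. Division by
    \<open>F j x\<close> = 0 gives the factor 0 in a product that is 0 anyway. Where
    \<open>g x\<close> = 0 all \<open>U j x\<close> vanish; elsewhere the factor tends to 1.\<close>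
  define f where "f j x = F j x * complex_of_real (min 1 (U j x / norm (F j x)))" for j x
  show ?thesis
  proof (rule that)
    show "simple_function M (f j)" for j
      unfolding f_def by (rule simple_function_compose2[OF F(1) U(2)])
    show "norm (f j x) \<le> norm (g x)" for j x
    proof -
      have nonneg: "0 \<le> min 1 (U j x / norm (F j x))" using U(4)[of j x] by simp
      have "norm (f j x) = norm (F j x) * min 1 (U j x / norm (F j x))"
        unfolding f_def norm_mult norm_of_real using nonneg by simp
      also have "\<dots> \<le> U j x"
      proof (cases "F j x = 0")
        case False
        have "norm (F j x) * min 1 (U j x / norm (F j x)) \<le> norm (F j x) * (U j x / norm (F j x))"
          by (intro mult_left_mono) simp_all
        then show ?thesis using False by simp
      qed (simp add: U(4))
      finally show ?thesis using U_le[of j x] by (rule order.trans)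
    qed
    show "(\<lambda>j. f j x) \<longlonglongrightarrow> g x" for x
    proof (cases "g x = 0")
      case True
      then have "U j x = 0" for j using U(4)[of j x] U_le[of j x] by simp
      then show ?thesis using True by (simp add: f_def)
    next
      case False
      have "(\<lambda>j. F j x * complex_of_real (min 1 (U j x / norm (F j x)))) \<longlonglongrightarrow>
          g x * complex_of_real (min 1 (norm (g x) / norm (g x)))"
        using False by (intro tendsto_mult F(2) tendsto_of_real tendsto_min tendsto_const
            tendsto_divide U_lim tendsto_norm) simp_all
      then show ?thesis using False by (simp add: f_def)
    qed
  qed
qed

section \<open>Passage from simple to measurable functions\<close>

context symmetric_correlations
begin

lemma abs_moment_mono:
  assumes "\<And>x. norm (f x) \<le> norm (g x)"
  shows "abs_moment f n \<le> abs_moment g n"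
  unfolding abs_moment_def
  by (intro nn_integral_mono mult_right_mono prod_mono_ennreal ennreal_leI assms) simp

lemma abs_expansion_mono:
  assumes "\<And>x. norm (f x) \<le> norm (g x)"
  shows "abs_expansion f \<le> abs_expansion g"
  unfolding abs_expansion_def
  by (intro suminf_le mult_left_mono abs_moment_mono assms) (simp_all add: summableI)

lemma moment_integrand_measurable:
  assumes g: "g \<in> borel_measurable M"
  shows "(\<lambda>x. (\<Prod>j<n. g (x j)) * complex_of_real (R n x)) \<in> borel_measurable (M_pow n)"
  by (intro borel_measurable_times borel_measurable_prod
      measurable_compose[OF measurable_M_pow_component g] measurable_compose[OF R_measurable]) simp_all

lemma nn_integral_norm_moment_integrand:
  "(\<integral>\<^sup>+x. ennreal (norm ((\<Prod>j<n. g (x j)) * complex_of_real (R n x))) \<partial>M_pow n) = abs_moment g n"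
  unfolding abs_moment_def
  by (intro nn_integral_cong) (simp add: norm_mult prod_norm[symmetric] ennreal_mult prod_nonneg R_nonneg prod_ennreal)

text \<open>For each n the integrand for g dominates those for the \<open>f j\<close>. Its integral
  \<open>abs_moment g n\<close>, divided by n!, is then a summable majorant of the series, as
  Tannery's theorem requires.\<close>

lemma moment_expansion_dominated_convergence:
  assumes f: "\<And>j. f j \<in> borel_measurable M" and g: "g \<in> borel_measurable M"
    and lim: "\<And>x. (\<lambda>j. f j x) \<longlonglongrightarrow> g x" and le: "\<And>j x. norm (f j x) \<le> norm (g x)"
    and fin: "abs_expansion g < \<infinity>"
  shows "(\<lambda>j. \<Sum>n. moment (f j) n / fact n) \<longlonglongrightarrow> (\<Sum>n. moment g n / fact n)"
proof -
  define w where "w n x = norm ((\<Prod>j<n. g (x j)) * complex_of_real (R n x))" for n x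
  have w_meas: "w n \<in> borel_measurable (M_pow n)" for n
    unfolding w_def using moment_integrand_measurable[OF g] by simp
  have w_int: "integrable (M_pow n) (w n)" for n
    using w_meas abs_moment_finite[OF fin, of n] nn_integral_norm_moment_integrand[of n g]
    by (intro integrableI_nonneg) (simp_all add: w_def)
  have le_w: "norm ((\<Prod>i<n. f j (x i)) * complex_of_real (R n x)) \<le> w n x" for n j x
    unfolding w_def norm_mult prod_norm[symmetric]
    by (intro mult_right_mono prod_mono conjI norm_ge_zero le)
  have moment_le: "norm (moment (f j) n / fact n) \<le> enn2real (abs_moment g n) / fact n" for j n
  proof -
    have int: "integrable (M_pow n) (\<lambda>x. (\<Prod>i<n. f j (x i)) * complex_of_real (R n x))"
    proof (rule Bochner_Integration.integrable_bound[OF w_int moment_integrand_measurable[OF f]])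
      show "AE x in M_pow n. norm ((\<Prod>i<n. f j (x i)) * complex_of_real (R n x)) \<le> norm (w n x)"
        by (intro AE_I2 order.trans[OF le_w]) simp
    qed
    have "norm (moment (f j) n) \<le> (LINT x|M_pow n. norm ((\<Prod>i<n. f j (x i)) * complex_of_real (R n x)))"
      unfolding moment_def by (rule integral_norm_bound)
    also have "\<dots> \<le> integral\<^sup>L (M_pow n) (w n)"
      by (intro integral_mono w_int integrable_norm int le_w)
    also have "\<dots> = enn2real (abs_moment g n)"
      using nn_integral_norm_moment_integrand[of n g]
      by (subst integral_eq_nn_integral[OF w_meas]) (simp_all add: w_def)
    finally show ?thesis by (simp add: norm_divide divide_right_mono)
  qed
  show ?thesis
  proof (rule conjunct2[OF conjunct2[OF tannerys_theorem[where M = "\<lambda>n. enn2real (abs_moment g n) / fact n"]]])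
    fix n
    have "(\<lambda>j. moment (f j) n) \<longlonglongrightarrow> moment g n"
      unfolding moment_def
    proof (rule integral_dominated_convergence[where w = "w n"])
      show "AE x in M_pow n. (\<lambda>j. (\<Prod>i<n. f j (x i)) * complex_of_real (R n x)) \<longlonglongrightarrow>
          (\<Prod>i<n. g (x i)) * complex_of_real (R n x)"
        by (intro AE_I2 tendsto_mult tendsto_prod tendsto_const lim)
    qed (auto intro!: moment_integrand_measurable f g w_int le_w)
    then show "(\<lambda>j. moment (f j) n / fact n) \<longlonglongrightarrow> moment g n / fact n"
      by (intro tendsto_divide tendsto_const) simp_all
  next
    show "\<forall>\<^sub>F (n, j) in sequentially \<times>\<^sub>F sequentially.
        norm (moment (f j) n / fact n) \<le> enn2real (abs_moment g n) / fact n"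
      using moment_le by (intro always_eventually allI) (simp add: case_prod_unfold)
  qed (simp_all add: summable_abs_moment[OF fin])
qed

text \<open>Fatou's lemma along the simple approximations provides an integrable bound.\<close>

lemma expectation_config_prod:
  assumes g: "g \<in> borel_measurable M" and fin: "abs_expansion g < \<infinity>"
    and ex: "AE \<xi> in P. has_config_prod (\<lambda>x. 1 + g x) \<xi> (p \<xi>)" and p: "p \<in> borel_measurable P"
  shows "integral\<^sup>L P p = (\<Sum>n. moment g n / fact n)"
proof -
  obtain f where f: "\<And>j. simple_function M (f j)" and lim: "\<And>x. (\<lambda>j. f j x) \<longlonglongrightarrow> g x"
    and le: "\<And>j x. norm (f j x) \<le> norm (g x)"
    using simple_function_approximation_dominated[OF g space_M] by blast
  have f_fin: "abs_expansion (f j) < \<infinity>" for j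
    using abs_expansion_mono[OF le] fin by (rule order.strict_trans1)
  define approx where "approx j Q D \<longleftrightarrow> Q \<in> borel_measurable P \<and> D \<in> borel_measurable P \<and>
    (AE \<xi> in P. finite {x. \<xi> x > 0 \<and> f j x \<noteq> 0} \<and>
       Q \<xi> = (\<Prod>x | \<xi> x > 0 \<and> f j x \<noteq> 0. (1 + f j x) ^ \<xi> x) \<and>
       D \<xi> = (\<Prod>x | \<xi> x > 0 \<and> f j x \<noteq> 0. (1 + norm (f j x)) ^ \<xi> x)) \<and>
    integral\<^sup>L P Q = (\<Sum>n. moment (f j) n / fact n) \<and>
    (\<integral>\<^sup>+\<xi>. ennreal (D \<xi>) \<partial>P) = abs_expansion (f j)" for j Q D
  have "\<exists>Q D. approx j Q D" for j
    unfolding approx_def by (rule simple_function_expectation[OF f f_fin]) (intro exI conjI)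
  then have "\<forall>j. \<exists>QD. approx j (fst QD) (snd QD)" by (simp add: split_paired_Ex)
  then obtain QD where "\<forall>j. approx j (fst (QD j)) (snd (QD j))"
    using choice[of "\<lambda>j QD. approx j (fst QD) (snd QD)"] by blast
  moreover define Q D where "Q j = fst (QD j)" and "D j = snd (QD j)" for j
  ultimately have "approx j (Q j) (D j)" for j by simp
  then have QD: "\<And>j. Q j \<in> borel_measurable P" "\<And>j. D j \<in> borel_measurable P"
    "\<And>j. AE \<xi> in P. finite {x. \<xi> x > 0 \<and> f j x \<noteq> 0} \<and>
       Q j \<xi> = (\<Prod>x | \<xi> x > 0 \<and> f j x \<noteq> 0. (1 + f j x) ^ \<xi> x) \<and>
       D j \<xi> = (\<Prod>x | \<xi> x > 0 \<and> f j x \<noteq> 0. (1 + norm (f j x)) ^ \<xi> x)"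
    "\<And>j. integral\<^sup>L P (Q j) = (\<Sum>n. moment (f j) n / fact n)"
    "\<And>j. (\<integral>\<^sup>+\<xi>. ennreal (D j \<xi>) \<partial>P) = abs_expansion (f j)"
    unfolding approx_def by simp_all
  \<comment> \<open>This is a liminf because the moduli of the approximations need not increase with
    j. It is at once almost surely finite and an integrable majorant of all
    \<open>Q j\<close>.\<close>
  define W where "W \<xi> = liminf (\<lambda>j. ennreal (D j \<xi>))" for \<xi>
  have W_meas: "W \<in> borel_measurable P"
    unfolding W_def using QD(2) by measurable
  have "(\<integral>\<^sup>+\<xi>. W \<xi> \<partial>P) \<le> liminf (\<lambda>j. \<integral>\<^sup>+\<xi>. ennreal (D j \<xi>) \<partial>P)"
    unfolding W_def using QD(2) by (intro nn_integral_liminf) measurable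
  also have "\<dots> \<le> liminf (\<lambda>j. abs_expansion g)"
    unfolding QD(5) by (intro Liminf_mono always_eventually allI abs_expansion_mono le)
  also have "\<dots> = abs_expansion g"
    by (simp add: Liminf_const)
  finally have W_fin: "(\<integral>\<^sup>+\<xi>. W \<xi> \<partial>P) < \<infinity>"
    using fin by (rule order.strict_trans1)
  then have W_AE: "AE \<xi> in P. W \<xi> \<noteq> \<infinity>"
    by (intro nn_integral_noteq_infinite[OF W_meas]) simp
  have "AE \<xi> in P. \<forall>j. finite {x. \<xi> x > 0 \<and> f j x \<noteq> 0} \<and>
       Q j \<xi> = (\<Prod>x | \<xi> x > 0 \<and> f j x \<noteq> 0. (1 + f j x) ^ \<xi> x) \<and>
       D j \<xi> = (\<Prod>x | \<xi> x > 0 \<and> f j x \<noteq> 0. (1 + norm (f j x)) ^ \<xi> x)"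
    unfolding AE_all_countable using QD(3) by blast
  then have conv: "AE \<xi> in P. (\<lambda>j. Q j \<xi>) \<longlonglongrightarrow> p \<xi> \<and> (\<forall>j. norm (Q j \<xi>) \<le> enn2real (W \<xi>))"
    using W_AE ex
  proof eventually_elim
    case (elim \<xi>)
    have fin\<xi>: "finite {x. \<xi> x > 0 \<and> f j x \<noteq> 0}"
      and Q: "Q j \<xi> = (\<Prod>x | \<xi> x > 0 \<and> f j x \<noteq> 0. (1 + f j x) ^ \<xi> x)"
      and D: "D j \<xi> = (\<Prod>x | \<xi> x > 0 \<and> f j x \<noteq> 0. (1 + norm (f j x)) ^ \<xi> x)" for j
      using elim(1) by simp_all
    have W: "W \<xi> = liminf (\<lambda>j. ennreal (\<Prod>x | \<xi> x > 0 \<and> f j x \<noteq> 0. (1 + norm (f j x)) ^ \<xi> x))"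
      by (simp add: W_def D)
    have W_lt: "W \<xi> < \<infinity>" using elim(2) by (simp add: less_top)
    note conv = config_prod_dominated_convergence[of f g \<xi>, OF lim le fin\<xi> W W_lt elim(3)]
    show ?case unfolding Q using conv by blast
  qed
  have "(\<lambda>j. integral\<^sup>L P (Q j)) \<longlonglongrightarrow> integral\<^sup>L P p"
  proof (rule integral_dominated_convergence[where w = "\<lambda>\<xi>. enn2real (W \<xi>)"])
    show "integrable P (\<lambda>\<xi>. enn2real (W \<xi>))"
    proof (rule integrableI_nonneg)
      show "(\<lambda>\<xi>. enn2real (W \<xi>)) \<in> borel_measurable P" using W_meas by simp
      have "(\<integral>\<^sup>+\<xi>. ennreal (enn2real (W \<xi>)) \<partial>P) \<le> (\<integral>\<^sup>+\<xi>. W \<xi> \<partial>P)"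
        by (intro nn_integral_mono) (simp add: ennreal_enn2real_if)
      then show "(\<integral>\<^sup>+\<xi>. ennreal (enn2real (W \<xi>)) \<partial>P) < \<infinity>"
        using W_fin by (rule order.strict_trans1)
    qed simp
    show "AE \<xi> in P. (\<lambda>j. Q j \<xi>) \<longlonglongrightarrow> p \<xi>" using conv by eventually_elim blast
    show "AE \<xi> in P. norm (Q j \<xi>) \<le> enn2real (W \<xi>)" for j using conv by eventually_elim blast
  qed (fact p QD(1))+
  moreover have "(\<lambda>j. integral\<^sup>L P (Q j)) \<longlonglongrightarrow> (\<Sum>n. moment g n / fact n)"
    unfolding QD(4)
    by (rule moment_expansion_dominated_convergence[OF borel_measurable_simple_function[OF f] g lim le fin])
  ultimately show ?thesis by (rule LIMSEQ_unique)
qed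

end

subsection \<open>Symmetry of the correlation functions\<close>

text \<open>A product measure is determined by its values on boxes, and the preimage of a box is the
  box with permuted sides.\<close>

lemma distr_PiM_permute:
  assumes "sigma_finite_measure M" "finite I" and \<pi>: "\<pi> permutes I"
  shows "distr (Pi\<^sub>M I (\<lambda>_. M)) (Pi\<^sub>M I (\<lambda>_. M)) (\<lambda>x. \<lambda>i\<in>I. x (\<pi> i)) = Pi\<^sub>M I (\<lambda>_. M)"
    and measurable_PiM_permute:
      "(\<lambda>x. \<lambda>i\<in>I. x (\<pi> i)) \<in> measurable (Pi\<^sub>M I (\<lambda>_. M)) (Pi\<^sub>M I (\<lambda>_. M))"
proof -
  interpret product_sigma_finite "\<lambda>_. M"
    using assms(1) by (simp add: product_sigma_finite_def)
  have \<pi>I: "\<pi> i \<in> I \<longleftrightarrow> i \<in> I" for i using permutes_in_image[OF \<pi>] .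
  have inv: "\<pi> (inv \<pi> i) = i" "inv \<pi> (\<pi> i) = i" for i using permutes_inverses[OF \<pi>] by auto
  have invI: "inv \<pi> i \<in> I \<longleftrightarrow> i \<in> I" for i using permutes_in_image[OF permutes_inv[OF \<pi>]] .
  show meas: "(\<lambda>x. \<lambda>i\<in>I. x (\<pi> i)) \<in> measurable (Pi\<^sub>M I (\<lambda>_. M)) (Pi\<^sub>M I (\<lambda>_. M))"
    by (intro measurable_restrict measurable_component_singleton) (simp add: \<pi>I)
  show "distr (Pi\<^sub>M I (\<lambda>_. M)) (Pi\<^sub>M I (\<lambda>_. M)) (\<lambda>x. \<lambda>i\<in>I. x (\<pi> i)) = Pi\<^sub>M I (\<lambda>_. M)"
  proof (rule PiM_eqI)
    fix A assume A: "\<And>i. i \<in> I \<Longrightarrow> A i \<in> sets M"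
    have "(\<lambda>x. \<lambda>i\<in>I. x (\<pi> i)) -` Pi\<^sub>E I A \<inter> space (Pi\<^sub>M I (\<lambda>_. M)) = (\<Pi>\<^sub>E i\<in>I. A (inv \<pi> i))"
    proof (intro equalityI subsetI)
      fix x assume x: "x \<in> (\<lambda>x. \<lambda>i\<in>I. x (\<pi> i)) -` Pi\<^sub>E I A \<inter> space (Pi\<^sub>M I (\<lambda>_. M))"
      then have *: "x (\<pi> i) \<in> A i" if "i \<in> I" for i using that by (auto simp: PiE_iff)
      show "x \<in> (\<Pi>\<^sub>E i\<in>I. A (inv \<pi> i))"
      proof (rule PiE_I)
        fix i assume "i \<in> I"
        then show "x i \<in> A (inv \<pi> i)" using *[of "inv \<pi> i"] by (simp add: invI inv)
      next
        fix i assume "i \<notin> I"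
        then show "x i = undefined" using x by (auto simp: space_PiM PiE_iff extensional_def)
      qed
    next
      fix x assume x: "x \<in> (\<Pi>\<^sub>E i\<in>I. A (inv \<pi> i))"
      have "x (\<pi> i) \<in> A i" if "i \<in> I" for i
        using PiE_mem[OF x, of "\<pi> i"] that by (simp add: \<pi>I inv)
      moreover have "x \<in> space (Pi\<^sub>M I (\<lambda>_. M))"
        unfolding space_PiM
      proof (rule PiE_I)
        fix i assume "i \<in> I"
        then show "x i \<in> space M"
          using PiE_mem[OF x, of i] sets.sets_into_space[OF A, of "inv \<pi> i"] by (auto simp: invI)
      qed (rule PiE_arb[OF x])
      ultimately show "x \<in> (\<lambda>x. \<lambda>i\<in>I. x (\<pi> i)) -` Pi\<^sub>E I A \<inter> space (Pi\<^sub>M I (\<lambda>_. M))"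
        by auto
    qed
    then have "emeasure (distr (Pi\<^sub>M I (\<lambda>_. M)) (Pi\<^sub>M I (\<lambda>_. M)) (\<lambda>x. \<lambda>i\<in>I. x (\<pi> i))) (Pi\<^sub>E I A) =
        emeasure (Pi\<^sub>M I (\<lambda>_. M)) (\<Pi>\<^sub>E i\<in>I. A (inv \<pi> i))"
      using A assms(2) by (subst emeasure_distr[OF meas]) (auto intro: sets_PiM_I_finite)
    also have "\<dots> = (\<Prod>i\<in>I. emeasure M (A (inv \<pi> i)))"
      using A assms(2) by (intro emeasure_PiM) (simp_all add: invI)
    also have "\<dots> = (\<Prod>i\<in>I. emeasure M (A i))"
      by (rule prod.reindex_bij_witness[of _ \<pi> "inv \<pi>"]) (simp_all add: inv invI \<pi>I)
    finally show "emeasure (distr (Pi\<^sub>M I (\<lambda>_. M)) (Pi\<^sub>M I (\<lambda>_. M)) (\<lambda>x. \<lambda>i\<in>I. x (\<pi> i))) (Pi\<^sub>E I A) =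
        (\<Prod>i\<in>I. emeasure M (A i))" .
  qed (use assms(2) in simp_all)
qed

section \<open>Sorting words into the block order of the correlation functions\<close>

definition sorted_word :: "nat \<Rightarrow> (nat \<Rightarrow> nat) \<Rightarrow> nat list" where
  "sorted_word m k = concat (map (\<lambda>i. replicate (k i) i) [0..<m])"

lemma block_list_sorted_word: "block_list m A k = map A (sorted_word m k)"
  by (simp add: block_list_def sorted_word_def map_concat comp_def)

lemma length_sorted_word: "length (sorted_word m k) = (\<Sum>i<m. k i)"
  by (induction m) (simp_all add: sorted_word_def)

lemma count_sorted_word: "count (mset (sorted_word m k)) i = (if i < m then k i else 0)"
  by (induction m) (auto simp: sorted_word_def)

lemma letter_count_Suc: "letter_count (Suc n) w i = letter_count n w i + (if w n = i then 1 else 0)"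
  using letter_count_fun_upd[of n w "w n" i] by simp

lemma count_mset_word: "count (mset (map w [0..<n])) i = letter_count n w i"
proof (induction n)
  case 0
  then show ?case by (simp add: letter_count_def)
next
  case (Suc n)
  then show ?case by (simp add: letter_count_Suc)
qed

text \<open>A word and its sorted form have the same letter counts, hence the same multiset of
  letters, and lists with equal multisets differ by a permutation of positions.\<close>

lemma sort_word:
  assumes w: "w \<in> {..<n} \<rightarrow> {..<m}"
  obtains \<pi> where "\<pi> permutes {..<n}" "\<And>j. j < n \<Longrightarrow> w j = sorted_word m (letter_count n w) ! \<pi> j"
    "(\<Sum>i<m. letter_count n w i) = n"
proof -
  have "letter_count n w i = 0" if "\<not> i < m" for i
  proof -
    have "{j. j < n \<and> w j = i} = {}" using w that by auto
    then show ?thesis unfolding letter_count_def by (simp only: card.empty)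
  qed
  then have eq: "mset (map w [0..<n]) = mset (sorted_word m (letter_count n w))"
    by (intro multiset_eqI) (simp only: count_mset_word count_sorted_word, simp)
  then have len: "length (sorted_word m (letter_count n w)) = n"
    using mset_eq_length[OF eq] by simp
  obtain \<pi> where \<pi>: "\<pi> permutes {..<n}" "permute_list \<pi> (sorted_word m (letter_count n w)) = map w [0..<n]"
    using mset_eq_permutation[OF eq] unfolding len by blast
  show ?thesis
  proof (rule that[OF \<pi>(1)])
    fix j assume j: "j < n"
    then show "w j = sorted_word m (letter_count n w) ! \<pi> j"
      using arg_cong[OF \<pi>(2), of "\<lambda>xs. xs ! j"] permute_list_nth[of \<pi> "sorted_word m (letter_count n w)" j] \<pi>(1)
      by (simp add: len)
  qed (use len length_sorted_word in simp)
qed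

lemma prod_indicator_PiE:
  fixes x :: "nat \<Rightarrow> 'a"
  assumes "x \<in> extensional {..<n}"
  shows "(\<Prod>j<n. indicator (B j) (x j) :: ennreal) = indicator (PiE {..<n} B) x"
proof (cases "x \<in> PiE {..<n} B")
  case True
  then have "x j \<in> B j" if "j < n" for j using that by (simp add: PiE_iff)
  then show ?thesis using True by simp
next
  case False
  then obtain j where j: "j < n" "x j \<notin> B j" using assms by (auto simp: PiE_iff)
  have "(\<Prod>j<n. indicator (B j) (x j) :: ennreal) = 0"
    by (rule prod_zero) (use j in \<open>auto intro!: bexI[of _ j]\<close>)
  then show ?thesis using False by simp
qed

text \<open>\<open>correlation_function\<close> covers blocks in sorted order only. A permutation of
  the coordinates brings any word into this order. It preserves the product measure and, almost
  everywhere, R, which agrees almost everywhere with the determinant of a self-dual matrix.\<close>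

lemma symmetric_correlation:
  assumes M: "sigma_finite_measure M" and R: "correlation_function M P n R"
    and D: "AE x in Pi\<^sub>M {..<n} (\<lambda>_. M). cq_of_complex (of_real (R x)) = Det_M n (\<lambda>i j. K (x i) (x j))"
    and K: "self_dual_kernel K"
    and A: "\<And>i. i < m \<Longrightarrow> A i \<in> sets M" "disjoint_family_on A {..<m}" and w: "w \<in> {..<n} \<rightarrow> {..<m}"
  shows "(\<integral>\<^sup>+\<xi>. (\<Prod>i<m. \<Prod>j<letter_count n w i. num_points \<xi> (A i) - of_nat j) \<partial>P) =
      (\<integral>\<^sup>+x. (\<Prod>j<n. indicator (A (w j)) (x j)) * ennreal (R x) \<partial>Pi\<^sub>M {..<n} (\<lambda>_. M))"
proof -
  let ?Mn = "Pi\<^sub>M {..<n} (\<lambda>_. M)"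
  obtain \<pi> where \<pi>: "\<pi> permutes {..<n}" and w\<pi>: "\<And>j. j < n \<Longrightarrow> w j = sorted_word m (letter_count n w) ! \<pi> j"
    and total: "(\<Sum>i<m. letter_count n w i) = n"
    using sort_word[OF w] by metis
  define b where "b = sorted_word m (letter_count n w)"
  have len: "length b = n" by (simp add: b_def length_sorted_word total)
  define \<rho> where "\<rho> = inv \<pi>"
  have \<rho>: "\<rho> permutes {..<n}" unfolding \<rho>_def by (rule permutes_inv[OF \<pi>])
  \<comment> \<open>Coordinate j of x is coordinate \<open>\<pi> j\<close> of \<open>T x\<close>, so
    T moves the block of the letter \<open>w j\<close> to its place in the sorted word.\<close>
  define T where "T x = (\<lambda>i\<in>{..<n}. x (\<rho> i))" for x :: "nat \<Rightarrow> 'a"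
  have T: "T \<in> measurable ?Mn ?Mn" "distr ?Mn ?Mn T = ?Mn"
    unfolding T_def[abs_def] using measurable_PiM_permute[OF M _ \<rho>] distr_PiM_permute[OF M _ \<rho>] by simp_all
  have R_meas: "R \<in> borel_measurable ?Mn" using R by (simp add: correlation_function_def)
  have ext: "x i = undefined" if "x \<in> space ?Mn" "\<not> i < n" for x i
    using that by (auto simp: space_PiM PiE_iff extensional_def)
  have R_det: "R x = Re (cq_scalar (Det_M n (\<lambda>i j. K (x i) (x j))))"
    if "cq_of_complex (of_real (R x)) = Det_M n (\<lambda>i j. K (x i) (x j))" for x
    using that by (metis Re_complex_of_real cq_scalar_simps(6))
  \<comment> \<open>The determinant formula for R holds only almost everywhere, so its validity at
    \<open>T x\<close> rests on T preserving the measure.\<close>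
  have "AE x in distr ?Mn ?Mn T. cq_of_complex (of_real (R x)) = Det_M n (\<lambda>i j. K (x i) (x j))"
    unfolding T(2) by (rule D)
  then have "AE x in ?Mn. cq_of_complex (of_real (R (T x))) = Det_M n (\<lambda>i j. K (T x i) (T x j))"
    by (rule AE_distrD[OF T(1)])
  then have R_T: "AE x in ?Mn. R (T x) = R x"
    using D AE_space
  proof eventually_elim
    case (elim x)
    have "T x = (\<lambda>i. x (\<rho> i))"
      using ext[OF elim(3)] permutes_not_in[OF \<rho>] by (auto simp: T_def fun_eq_iff)
    then have "Det_M n (\<lambda>i j. K (T x i) (T x j)) = Det_M n (\<lambda>i j. K (x (\<rho> i)) (x (\<rho> j)))" by simp
    moreover have "cq_scalar (Det_M n (\<lambda>i j. K (x (\<rho> i)) (x (\<rho> j)))) = cq_scalar (Det_M n (\<lambda>i j. K (x i) (x j)))"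
      by (rule cq_scalar_Det_M_permute[of "\<lambda>i j. K (x i) (x j)", OF _ \<rho>])
        (use K in \<open>unfold self_dual_kernel_def, blast\<close>)
    ultimately show ?case
      unfolding R_det[OF elim(1)] R_det[OF elim(2)] by simp
  qed
  define F where "F x = (\<Prod>i<n. indicator (A (b ! i)) (x i)) * ennreal (R x)" for x
  have F_meas: "F \<in> borel_measurable ?Mn"
  proof -
    have "b ! i < m" if "i < n" for i
      using nth_mem[of i b] that len by (auto simp: b_def sorted_word_def)
    then have "(\<lambda>x. indicator (A (b ! i)) (x i) :: ennreal) \<in> borel_measurable ?Mn" if "i < n" for i
      using that by (intro measurable_compose[OF measurable_component_singleton borel_measurable_indicator] A) simp_all
    then show ?thesis
      unfolding F_def[abs_def] using R_meas by (intro borel_measurable_times_ennreal borel_measurable_prod_ennreal) simp_all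
  qed
  have "AE x in ?Mn. (\<Prod>j<n. indicator (A (w j)) (x j)) * ennreal (R x) = F (T x)"
    using R_T
  proof eventually_elim
    case (elim x)
    have "(\<Prod>j<n. indicator (A (w j)) (x j) :: ennreal) = (\<Prod>i<n. indicator (A (b ! i)) (x (\<rho> i)))"
    proof (rule prod.reindex_bij_witness[of _ \<rho> \<pi>])
      fix j assume j: "j \<in> {..<n}"
      show "\<rho> (\<pi> j) = j" by (simp add: \<rho>_def permutes_inverses[OF \<pi>])
      show "\<pi> j \<in> {..<n}" using j permutes_in_image[OF \<pi>] by simp
      show "indicator (A (b ! \<pi> j)) (x (\<rho> (\<pi> j))) = (indicator (A (w j)) (x j) :: ennreal)"
        using w\<pi>[of j] j by (simp add: b_def \<rho>_def permutes_inverses[OF \<pi>])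
      show "\<pi> (\<rho> j) = j" by (simp add: \<rho>_def permutes_inverses[OF \<pi>])
      show "\<rho> j \<in> {..<n}" using j permutes_in_image[OF \<rho>] by simp
    qed
    also have "\<dots> = (\<Prod>i<n. indicator (A (b ! i)) (T x i))"
      by (rule prod.cong) (simp_all add: T_def)
    finally show ?case unfolding F_def elim by simp
  qed
  then have "(\<integral>\<^sup>+x. (\<Prod>j<n. indicator (A (w j)) (x j)) * ennreal (R x) \<partial>?Mn) = (\<integral>\<^sup>+x. F (T x) \<partial>?Mn)"
    by (rule nn_integral_cong_AE)
  also have "\<dots> = (\<integral>\<^sup>+x. F x \<partial>distr ?Mn ?Mn T)"
    by (rule nn_integral_distr[OF T(1), symmetric]) (simp add: F_meas)
  also have "\<dots> = (\<integral>\<^sup>+x. F x \<partial>?Mn)" unfolding T(2) ..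
  also have "\<dots> = (\<integral>\<^sup>+x\<in>PiE {..<n} (\<lambda>i. block_list m A (letter_count n w) ! i). ennreal (R x) \<partial>?Mn)"
  proof (rule nn_integral_cong)
    fix x assume "x \<in> space ?Mn"
    then have x: "x \<in> extensional {..<n}" by (simp add: space_PiM PiE_iff)
    have "(\<Prod>i<n. indicator (A (b ! i)) (x i) :: ennreal) =
        (\<Prod>i<n. indicator (block_list m A (letter_count n w) ! i) (x i))"
      by (rule prod.cong) (simp_all add: block_list_sorted_word len b_def[symmetric])
    then show "F x = ennreal (R x) * indicator (PiE {..<n} (\<lambda>i. block_list m A (letter_count n w) ! i)) x"
      unfolding F_def by (simp add: prod_indicator_PiE[OF x] mult.commute)
  qed
  also have "\<dots> = (\<integral>\<^sup>+\<xi>. (\<Prod>i<m. \<Prod>j<letter_count n w i. num_points \<xi> (A i) - of_nat j) \<partial>P)"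
    using R A total unfolding correlation_function_def by simp
  finally show ?thesis by (rule sym)
qed

lemma nn_integral_PiM_empty: "(\<integral>\<^sup>+x. h x \<partial>Pi\<^sub>M {..<0::nat} (\<lambda>_. M)) = h (\<lambda>_. undefined)"
  by (simp add: PiM_empty nn_integral_count_space_finite)

text \<open>\<open>pfaffian_field\<close> supplies densities for n \<ge> 1. Setting
  \<open>R 0\<close> to 1 extends the correlation identity to n = 0, where it says that P has total
  mass 1.\<close>

lemma pfaffian_field_correlations:
  assumes M: "sigma_finite_measure M" "sets M = sets borel" and P: "pfaffian_field M P K"
  obtains R where "symmetric_correlations M P R" "R 0 = (\<lambda>_. 1)"
    "\<And>n. n \<ge> 1 \<Longrightarrow> AE x in Pi\<^sub>M {..<n} (\<lambda>_. M). cq_scalar (Det_M n (\<lambda>i j. K (x i) (x j))) = of_real (R n x)"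
proof -
  define Q where "Q n R \<longleftrightarrow> correlation_function M P n R \<and> (AE x in Pi\<^sub>M {..<n} (\<lambda>_. M).
           cq_of_complex (of_real (R x)) = Det_M n (\<lambda>i j. K (x i) (x j)))" for n R
  have "\<forall>n. \<exists>R. n \<ge> 1 \<longrightarrow> Q n R"
    using P unfolding pfaffian_field_def Q_def by blast
  then obtain R' where R': "\<And>n. n \<ge> 1 \<Longrightarrow> Q n (R' n)"
    using choice[of "\<lambda>n R. n \<ge> 1 \<longrightarrow> Q n R"] by blast
  have field: "random_point_field P" and K: "self_dual_kernel K"
    using P by (simp_all add: pfaffian_field_def)
  have prob: "prob_space P" using field by (simp add: random_point_field_def)
  define R where "R n = (if n = 0 then (\<lambda>_. 1) else R' n)" for n
  have R0: "R 0 = (\<lambda>_. 1)" by (simp add: R_def)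
  have Q: "Q n (R n)" if "n \<ge> 1" for n using R'[OF that] that by (simp add: R_def)
  show ?thesis
  proof (rule that)
    show "symmetric_correlations M P R"
    proof unfold_locales
      show "R n \<in> borel_measurable (Pi\<^sub>M {..<n} (\<lambda>_. M))" "0 \<le> R n x" for n x
        using Q[of n] by (cases "n = 0"; simp add: R0 Q_def correlation_function_def)+
      fix n m :: nat and A :: "nat \<Rightarrow> 'a set" and w :: "nat \<Rightarrow> nat"
      assume A: "\<And>i. i < m \<Longrightarrow> A i \<in> sets M" "disjoint_family_on A {..<m}" and w: "w \<in> {..<n} \<rightarrow> {..<m}"
      show "(\<integral>\<^sup>+\<xi>. (\<Prod>i<m. \<Prod>j<letter_count n w i. num_points \<xi> (A i) - of_nat j) \<partial>P) =
        (\<integral>\<^sup>+x. (\<Prod>j<n. indicator (A (w j)) (x j)) * ennreal (R n x) \<partial>Pi\<^sub>M {..<n} (\<lambda>_. M))"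
      proof (cases "n = 0")
        case True
        have "(\<integral>\<^sup>+x. (\<Prod>j<n. indicator (A (w j)) (x j)) * ennreal (R n x) \<partial>Pi\<^sub>M {..<n} (\<lambda>_. M)) = 1"
          unfolding True nn_integral_PiM_empty by (simp add: R0)
        then show ?thesis
          using prob_space.emeasure_space_1[OF prob] by (simp add: True letter_count_def)
      next
        case False
        then have "Q n (R n)" by (intro Q) simp
        then show ?thesis
          unfolding Q_def by (intro symmetric_correlation[OF M(1) _ _ K A w]) simp_all
      qed
    qed (fact M(2) field)+
    show "AE x in Pi\<^sub>M {..<n} (\<lambda>_. M). cq_scalar (Det_M n (\<lambda>i j. K (x i) (x j))) = of_real (R n x)"
      if "n \<ge> 1" for n
    proof -
      have "AE x in Pi\<^sub>M {..<n} (\<lambda>_. M). cq_of_complex (of_real (R n x)) = Det_M n (\<lambda>i j. K (x i) (x j))"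
        using Q[OF that] by (simp add: Q_def)
      then show ?thesis
      proof eventually_elim
        case (elim x)
        show ?case unfolding elim[symmetric] by simp
      qed
    qed
  qed (rule R0)
qed

subsection \<open>The Fredholm expansion\<close>

context symmetric_correlations
begin

lemma no_points_outside_support:
  assumes N: "N \<in> sets M" and zero: "(\<integral>\<^sup>+x. indicator N (x 0) * ennreal (R 1 x) \<partial>M_pow 1) = 0"
  shows "AE \<xi> in P. num_points \<xi> N = 0"
proof -
  have "(\<integral>\<^sup>+\<xi>. num_points \<xi> N \<partial>P) = 0"
    unfolding one_point_moment[OF N] by (rule zero)
  then show ?thesis
    by (subst (asm) nn_integral_0_iff_AE[OF num_points_measurable[OF N]])
qed

text \<open>Split the space into N and its complement. A word containing the letter 0 has a
  factorial moment with the factor \<open>num_points \<xi> N\<close>, which is almost surely 0, so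
  the density integrates to 0 over its product of blocks. Finitely many such words cover all tuples
  meeting N.\<close>

lemma density_zero_outside_support:
  assumes N: "N \<in> sets M" and empty: "AE \<xi> in P. num_points \<xi> N = 0"
  shows "AE x in M_pow n. (\<exists>j<n. x j \<in> N) \<longrightarrow> R n x = 0"
proof -
  define A where "A i = (if i = 0 then N else UNIV - N)" for i :: nat
  have A: "A i \<in> sets M" for i
    using N sets.compl_sets[OF N] by (simp add: A_def space_M)
  have disj: "disjoint_family_on A {..<2}"
    by (auto simp: disjoint_family_on_def A_def)
  define W where "W = {w \<in> {..<n} \<rightarrow>\<^sub>E {..<2::nat}. \<exists>j<n. w j = 0}"
  have "AE x in M_pow n. (\<Prod>j<n. indicator (A (w j)) (x j)) * ennreal (R n x) = 0" if w: "w \<in> W" for w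
  proof -
    obtain j where j: "j < n" "w j = 0" using w by (auto simp: W_def)
    have pos: "0 < letter_count n w 0"
      unfolding letter_count_def card_gt_0_iff using j by auto
    have meas: "(\<lambda>x. (\<Prod>j<n. indicator (A (w j)) (x j)) * ennreal (R n x)) \<in> borel_measurable (M_pow n)"
      by (intro borel_measurable_times_ennreal borel_measurable_prod_ennreal
          measurable_compose[OF measurable_M_pow_component borel_measurable_indicator]
          measurable_compose[OF R_measurable measurable_ennreal] A) simp
    have "(\<integral>\<^sup>+x. (\<Prod>j<n. indicator (A (w j)) (x j)) * ennreal (R n x) \<partial>M_pow n) =
        (\<integral>\<^sup>+\<xi>. (\<Prod>i<2. \<Prod>j<letter_count n w i. num_points \<xi> (A i) - of_nat j) \<partial>P)"
      using w by (intro correlation[symmetric] A disj) (auto simp: W_def)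
    also have "\<dots> = (\<integral>\<^sup>+\<xi>. 0 \<partial>P)"
    proof (rule nn_integral_cong_AE)
      show "AE \<xi> in P. (\<Prod>i<2. \<Prod>j<letter_count n w i. num_points \<xi> (A i) - of_nat j) = 0"
        using empty
      proof eventually_elim
        case (elim \<xi>)
        have "num_points \<xi> (A 0) - of_nat 0 = 0" by (simp add: A_def elim)
        with pos have "\<exists>j\<in>{..<letter_count n w 0}. num_points \<xi> (A 0) - of_nat j = 0" by blast
        then have zero: "(\<Prod>j<letter_count n w 0. num_points \<xi> (A 0) - of_nat j) = 0"
          by (rule prod_zero[OF finite_lessThan])
        have "\<exists>i\<in>{..<2}. (\<Prod>j<letter_count n w i. num_points \<xi> (A i) - of_nat j) = 0"
          by (rule bexI[of _ 0]) (rule zero, simp)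
        then show ?case by (rule prod_zero[OF finite_lessThan])
      qed
    qed
    finally show ?thesis
      by (subst nn_integral_0_iff_AE[OF meas, symmetric]) simp
  qed
  moreover have "finite W" unfolding W_def by (rule finite_subset[OF _ finite_PiE[of "{..<n}" "\<lambda>_. {..<2::nat}"]]) auto
  ultimately have "AE x in M_pow n. \<forall>w\<in>W. (\<Prod>j<n. indicator (A (w j)) (x j)) * ennreal (R n x) = 0"
    by (intro AE_finite_allI)
  then show ?thesis
  proof eventually_elim
    case (elim x)
    show ?case
    proof
      assume ex: "\<exists>j<n. x j \<in> N"
      define w where "w = (\<lambda>j\<in>{..<n}. if x j \<in> N then 0 else 1 :: nat)"
      have "w \<in> W" using ex by (auto simp: W_def w_def)
      with elim have "(\<Prod>j<n. indicator (A (w j)) (x j)) * ennreal (R n x) = 0" by (rule bspec)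
      moreover have "(\<Prod>j<n. indicator (A (w j)) (x j) :: ennreal) = 1"
        by (rule prod.neutral) (simp add: w_def A_def)
      ultimately have "ennreal (R n x) = 0" by simp
      then show "R n x = 0" using R_nonneg[of n x] by (simp add: ennreal_eq_0_iff)
    qed
  qed
qed

end

section \<open>Limits defining products over configurations, and the scaled integrand\<close>

lemma has_config_prod_unique:
  assumes "has_config_prod g \<xi> p" "has_config_prod g \<xi> q"
  shows "p = q"
  using assms unfolding has_config_prod_def
  by (rule tendsto_unique[OF finite_subsets_at_top_neq_bot])

lemma has_config_prod_config_prod:
  assumes "\<exists>p. has_config_prod g \<xi> p"
  shows "has_config_prod g \<xi> (config_prod g \<xi>)"
  using assms has_config_prod_unique unfolding config_prod_def by (metis theI)

lemma has_config_prod_cong: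
  assumes "\<And>x. \<xi> x > 0 \<Longrightarrow> g x = h x"
  shows "has_config_prod g \<xi> p \<longleftrightarrow> has_config_prod h \<xi> p"
  unfolding has_config_prod_def
proof (rule tendsto_cong)
  show "\<forall>\<^sub>F F in finite_subsets_at_top {x. \<xi> x > 0}. (\<Prod>x\<in>F. g x ^ \<xi> x) = (\<Prod>x\<in>F. h x ^ \<xi> x)"
    by (rule eventually_finite_subsets_at_top_weakI) (auto intro!: prod.cong simp: assms)
qed

text \<open>Only squares of the scaling factors survive in the determinant, so the choice of square
  root disappears.\<close>

lemma fredholm_integrand_scale:
  assumes "\<And>x. (s x)\<^sup>2 = f x"
  shows "fredholm_integrand (\<lambda>x y. cq_of_complex (s x) * K x y * cq_of_complex (s y)) n x =
    (\<Prod>i<n. f (x i)) * cq_scalar (Det_M n (\<lambda>i j. K (x i) (x j)))"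
  unfolding fredholm_integrand_def Det_M_scale[of n "\<lambda>i. s (x i)" "\<lambda>i j. K (x i) (x j)"]
  by (simp add: assms)

theorem theorem1p10:
  fixes M :: "'a::{second_countable_topology, t2_space} measure"
    and P :: "'a config measure"
    and K :: "'a \<Rightarrow> 'a \<Rightarrow> cquat"
    and f sqrt_f :: "'a \<Rightarrow> complex"
  assumes "locally compact (UNIV :: 'a set)"
    and "sigma_finite_measure M" and "sets M = sets borel"
    and "pfaffian_field M P K"
    and "finite_rank_kernel M K"
    and "\<And>x. (sqrt_f x)\<^sup>2 = f x"
    and "expected_config_prod_defined P (\<lambda>x. 1 + f x)"
    and "fredholm_Det_M_defined M
           (\<lambda>x y. cq_of_complex (sqrt_f x) * K x y * cq_of_complex (sqrt_f y))"
  shows "(LINT \<xi>|P. config_prod (\<lambda>x. 1 + f x) \<xi>) =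
         fredholm_Det_M M
           (\<lambda>x y. cq_of_complex (sqrt_f x) * K x y * cq_of_complex (sqrt_f y))"
proof -
  obtain R where corr: "symmetric_correlations M P R" and R0: "R 0 = (\<lambda>_. 1)"
    and det: "\<And>n. n \<ge> 1 \<Longrightarrow> AE x in Pi\<^sub>M {..<n} (\<lambda>_. M). cq_scalar (Det_M n (\<lambda>i j. K (x i) (x j))) = of_real (R n x)"
    using pfaffian_field_correlations[OF assms(2-4)] by blast
  interpret symmetric_correlations M P R by (rule corr)
  define I where "I n = fredholm_integrand
    (\<lambda>x y. cq_of_complex (sqrt_f x) * K x y * cq_of_complex (sqrt_f y)) n" for n
  have I_int: "integrable (M_pow n) (I n)" if "n \<ge> 1" for n
    using assms(8) that by (simp add: fredholm_Det_M_defined_def I_def)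
  have I_summable: "summable (\<lambda>n. (LINT x|M_pow (Suc n). norm (I (Suc n) x)) / fact (Suc n))"
    using assms(8) unfolding fredholm_Det_M_defined_def I_def by (rule conjunct2)
  have I_AE: "AE x in M_pow n. I n x = (\<Prod>i<n. f (x i)) * of_real (R n x)" if "n \<ge> 1" for n
    using det[OF that]
  proof eventually_elim
    case (elim x)
    show ?case unfolding I_def fredholm_integrand_scale[OF assms(6)] elim ..
  qed

  \<comment> \<open>M is identified with \<open>M_pow 1\<close>. There the Fredholm integrand is
    measurable and equals f R_1 almost everywhere, so dividing it by R_1 gives a measurable
    substitute for f.\<close>
  define h where "h y = I 1 (\<lambda>i\<in>{0::nat}. y)" for y
  define r where "r y = R 1 (\<lambda>i\<in>{0::nat}. y)" for y
  have emb: "(\<lambda>y. \<lambda>i\<in>{0::nat}. y) \<in> measurable M (M_pow 1)"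
    by (simp add: lessThan_Suc measurable_restrict)
  have h_meas: "h \<in> borel_measurable M"
    unfolding h_def using I_int[of 1] by (intro measurable_compose[OF emb]) simp
  have r_meas: "r \<in> borel_measurable M"
    unfolding r_def by (intro measurable_compose[OF emb] R_measurable)
  have distr: "distr M (M_pow 1) (\<lambda>y. \<lambda>i\<in>{0::nat}. y) = M_pow 1"
    using product_sigma_finite.distr_component[of "\<lambda>_. M" "0::nat"] assms(2)
    by (simp add: product_sigma_finite_def lessThan_Suc)
  have "AE x in distr M (M_pow 1) (\<lambda>y. \<lambda>i\<in>{0::nat}. y). I 1 x = (\<Prod>i<1. f (x i)) * of_real (R 1 x)"
    unfolding distr by (rule I_AE) simp
  then have "AE y in M. h y = f y * of_real (r y)"
    using AE_distrD[OF emb] by (fastforce simp: h_def r_def)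
  then obtain Z where Z: "{y \<in> space M. h y \<noteq> f y * of_real (r y)} \<subseteq> Z" "emeasure M Z = 0" "Z \<in> sets M"
    by (rule AE_E)
  \<comment> \<open>On N either the division by r fails or h = f r may be violated. As r vanishes
    almost everywhere on N, the expected number of points in N is 0.\<close>
  define N where "N = {y \<in> space M. r y = 0} \<union> Z"
  define g where "g y = (if r y = 0 then 0 else h y / of_real (r y))" for y
  have N: "N \<in> sets M" unfolding N_def using r_meas Z(3) by measurable
  have g_meas: "g \<in> borel_measurable M" unfolding g_def using h_meas r_meas by measurable
  have gf: "g y = f y" if "y \<notin> N" for y
  proof -
    have "r y \<noteq> 0" "h y = f y * of_real (r y)" using that Z(1) by (auto simp: N_def space_M)
    then show ?thesis by (simp add: g_def)
  qed
  have "(\<integral>\<^sup>+x. indicator N (x 0) * ennreal (R 1 x) \<partial>M_pow 1) =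
      (\<integral>\<^sup>+x. indicator N (x 0) * ennreal (R 1 x) \<partial>distr M (M_pow 1) (\<lambda>y. \<lambda>i\<in>{0::nat}. y))"
    unfolding distr ..
  also have "\<dots> = (\<integral>\<^sup>+y. indicator N y * ennreal (r y) \<partial>M)"
  proof (subst nn_integral_distr[OF emb])
    show "(\<lambda>x. indicator N (x 0) * ennreal (R 1 x)) \<in> borel_measurable (distr M (M_pow 1) (\<lambda>y. \<lambda>i\<in>{0::nat}. y))"
      unfolding distr
      by (intro borel_measurable_times_ennreal measurable_compose[OF measurable_M_pow_component borel_measurable_indicator]
          measurable_compose[OF R_measurable measurable_ennreal] N) simp
  qed (simp add: r_def)
  also have "\<dots> = (\<integral>\<^sup>+y. 0 \<partial>M)"
  proof (rule nn_integral_cong_AE)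
    have "AE y in M. y \<notin> Z" using Z(2,3) by (intro AE_not_in) (simp add: null_sets_def)
    then show "AE y in M. indicator N y * ennreal (r y) = 0"
      by eventually_elim (auto simp: N_def indicator_def)
  qed
  finally have empty: "AE \<xi> in P. num_points \<xi> N = 0"
    by (intro no_points_outside_support[OF N]) simp

  \<comment> \<open>Off N the functions f and g agree, and almost everywhere \<open>R n\<close>
    vanishes at tuples with a coordinate in N.\<close>
  have I_g: "AE x in M_pow n. I n x = (\<Prod>i<n. g (x i)) * of_real (R n x)" if "n \<ge> 1" for n
    using I_AE[OF that] density_zero_outside_support[OF N empty, of n]
  proof eventually_elim
    case (elim x)
    show ?case
    proof (cases "\<exists>j<n. x j \<in> N")
      case True
      then show ?thesis using elim by simp
    next
      case False
      then have "(\<Prod>i<n. g (x i)) = (\<Prod>i<n. f (x i))" by (intro prod.cong) (auto simp: gf)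
      then show ?thesis using elim by simp
    qed
  qed
  have moment: "moment g n = (LINT x|M_pow n. I n x)" if "n \<ge> 1" for n
    unfolding moment_def
  proof (rule integral_cong_AE[symmetric, OF _ moment_integrand_measurable[OF g_meas] I_g[OF that]])
    show "I n \<in> borel_measurable (M_pow n)" using I_int[OF that] by simp
  qed
  \<comment> \<open>Because \<open>R n\<close> is nonnegative, the absolute moment is the integral
    of the modulus of the Fredholm integrand; this turns the absolute convergence of the expansion
    into finiteness of \<open>abs_expansion g\<close>.\<close>
  have abs_moment: "abs_moment g n = ennreal (LINT x|M_pow n. norm (I n x))" if "n \<ge> 1" for n
  proof -
    have "abs_moment g n = (\<integral>\<^sup>+x. ennreal (norm (I n x)) \<partial>M_pow n)"
      unfolding nn_integral_norm_moment_integrand[symmetric]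
      by (rule nn_integral_cong_AE) (use I_g[OF that] in eventually_elim, simp)
    also have "\<dots> = ennreal (LINT x|M_pow n. norm (I n x))"
      by (rule nn_integral_eq_integral) (simp_all add: I_int[OF that])
    finally show ?thesis .
  qed
  have abs0: "abs_moment g 0 = 1"
    unfolding abs_moment_def nn_integral_PiM_empty by (simp add: R0)
  have moment0: "moment g 0 = 1"
    by (simp add: moment_def R0 PiM_empty lebesgue_integral_count_space_finite)

  \<comment> \<open>The Fredholm series starts at n = 1; the term 1 for n = 0 is put back.\<close>
  define a where "a n = (if n = 0 then 1 else (LINT x|M_pow n. norm (I n x)) / fact n)" for n
  have a_nonneg: "0 \<le> a n" for n by (simp add: a_def)
  have "summable a"
    by (subst summable_Suc_iff[symmetric]) (use I_summable in \<open>simp add: a_def\<close>)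
  have "ennreal (1 / fact n) * abs_moment g n = ennreal (a n)" for n
    by (cases "n = 0") (simp_all add: abs0 abs_moment a_def flip: ennreal_mult)
  then have "abs_expansion g = ennreal (\<Sum>n. a n)"
    unfolding abs_expansion_def using suminf_ennreal2[OF a_nonneg \<open>summable a\<close>] by simp
  then have fin: "abs_expansion g < \<infinity>" by simp

  have ex: "AE \<xi> in P. \<exists>p. has_config_prod (\<lambda>x. 1 + f x) \<xi> p"
    and meas: "config_prod (\<lambda>x. 1 + f x) \<in> borel_measurable P"
    using assms(7) by (auto simp: expected_config_prod_defined_def)
  \<comment> \<open>Almost surely the configuration has no point in N, so f may be replaced by g in
    every factor.\<close>
  have "AE \<xi> in P. has_config_prod (\<lambda>x. 1 + g x) \<xi> (config_prod (\<lambda>x. 1 + f x) \<xi>)"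
    using ex empty
  proof eventually_elim
    case (elim \<xi>)
    have lt: "num_points \<xi> N < \<infinity>" using elim(2) by simp
    have "point_count \<xi> N = 0" by (simp add: point_count_def elim(2))
    then have "(\<Sum>x | x \<in> N \<and> \<xi> x > 0. \<xi> x) = 0"
      unfolding num_points_finite(2)[OF lt] .
    then have all: "\<forall>x\<in>{x \<in> N. \<xi> x > 0}. \<xi> x = 0"
      unfolding sum_eq_0_iff[OF num_points_finite(1)[OF lt]] .
    have eq: "1 + g x = 1 + f x" if "\<xi> x > 0" for x
    proof -
      have "x \<notin> N"
      proof
        assume "x \<in> N"
        with that have "\<xi> x = 0" by (intro bspec[OF all]) simp
        with that show False by simp
      qed
      then show ?thesis by (simp add: gf)
    qed
    have "has_config_prod (\<lambda>x. 1 + f x) \<xi> (config_prod (\<lambda>x. 1 + f x) \<xi>)"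
      using elim(1) by (rule has_config_prod_config_prod)
    then show ?case
      using has_config_prod_cong[of \<xi> "\<lambda>x. 1 + g x" "\<lambda>x. 1 + f x"] eq by simp
  qed
  then have "integral\<^sup>L P (config_prod (\<lambda>x. 1 + f x)) = (\<Sum>n. moment g n / fact n)"
    by (rule expectation_config_prod[OF g_meas fin _ meas])
  also have "\<dots> = 1 + (\<Sum>n. moment g (Suc n) / fact (Suc n))"
  proof -
    have "summable (\<lambda>n. moment g (Suc n) / fact (Suc n))"
    proof (rule summable_comparison_test'[OF I_summable, of 0])
      fix n
      show "norm (moment g (Suc n) / fact (Suc n)) \<le> (LINT x|M_pow (Suc n). norm (I (Suc n) x)) / fact (Suc n)"
        unfolding moment[of "Suc n", simplified] norm_divide norm_fact
        by (intro divide_right_mono integral_norm_bound) simp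
    qed
    then have "summable (\<lambda>n. moment g n / fact n)" by (subst (asm) summable_Suc_iff)
    from suminf_split_head[OF this] show ?thesis by (simp add: moment0)
  qed
  also have "\<dots> = fredholm_Det_M M (\<lambda>x y. cq_of_complex (sqrt_f x) * K x y * cq_of_complex (sqrt_f y))"
    unfolding fredholm_Det_M_def using moment[of "Suc n" for n] by (simp add: I_def)
  finally show ?thesis .
qed

end
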